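(* Let $a,b,c$ be positive numbers with $a<b<c$, $b-a<c_0<a$, $0<c_1<2a-b$, $\lfloor c/b\rfloor\ge2$, $a/b=p/q$ for coprime positive integers $p,q$, and $c/b\in\mathbb Z/q$, where $c_0=c-\lfloor c/b\rfloor b$ and $c_1=\lfloor c/b\rfloor b-\lfloor\lfloor c/b\rfloor b/a\rfloor a$. Then $\mathcal S_{a,b,c}\ne\emptyset$ if and only if one of the following holds: 1) $c_0<\gcd(a,c_1)$; 2) $b-c_0<\gcd(a,c_1+b)$; 3) there exist nonnegative integers $d_1,d_2,d_3,d_4$ such that, with $N=d_1+d_2+d_3+d_4+2$ and $B_d=a-(d_1+d_2+1)(b-a)$: $0<B_d\in N(b/q)\mathbb Z$; $Nc_1+(d_1+d_3+1)(b-a)\in a\mathbb Z$; $(d_1+d_2+1)(Nc_1+(d_1+d_3+1)(b-a))-(d_1+d_3+1)a\in Na\mathbb Z$; $c_0=(d_1+1)(b-a)+(d_1+d_3+1)B_d/N+\delta$ for some $\delta$ with $-\min(B_d/N,a-c_0)<\delta<\min(B_d/N,c_0+a-b)$; $\gcd(Nc_1+(d_1+d_3+1)(b-a),Na)=a$; and $\#E^d_{a,b,c}=d_1$, where $E^d_{a,b,c}=\{n\in\mathbb Z\cap[1,d_1+d_2+1]: n(Nc_1+(d_1+d_3+1)(b-a))\in(0,(d_1+d_3+1)a)+Na\mathbb Z\}$.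
   Context: For $a,b,c>0$ and $t\in\mathbb R$, $\mathbf M_{a,b,c}(t)=(\chi_{[0,c)}(t-\mu+\lambda))_{\mu\in a\mathbb Z,\lambda\in b\mathbb Z}$ is the infinite matrix with rows indexed by $a\mathbb Z$ and columns by $b\mathbb Z$, acting by $(\mathbf M_{a,b,c}(t)\mathbf x)(\mu)=\sum_{\lambda\in b\mathbb Z}\chi_{[0,c)}(t-\mu+\lambda)\mathbf x(\lambda)$. $\mathcal B_b^0$ is the set of vectors $(\mathbf x(\lambda))_{\lambda\in b\mathbb Z}$ with entries in $\{0,1\}$ and $\mathbf x(0)=1$. $\mathbf 1$ denotes the vector indexed by $a\mathbb Z$ with all entries $1$. $\mathcal S_{a,b,c}=\{t:\mathbf M_{a,b,c}(t)\mathbf x=\mathbf 1\text{ for some }\mathbf x\in\mathcal B_b^0\}$. $\#$ denotes cardinality and $A+r\mathbb Z=\{x+rk:x\in A,k\in\mathbb Z\}$. For positive $x,y$ in the lattice $(b/q)\mathbb Z$, $\gcd(x,y)$ is the largest $d\in(b/q)\mathbb Z$, $d>0$, with $x,y\in d\mathbb Z$. *)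

theory Defs
  imports Complex_Main "HOL-Library.Indicator_Function"
begin

definition in_lat :: "real \<Rightarrow> real \<Rightarrow> bool" where
  "in_lat x d \<longleftrightarrow> (\<exists>k::int. x = of_int k * d)"

text \<open>Row mu = m*a of M_{a,b,c}(t) applied to x, where x is indexed by k with lambda = k*b:
  sum over lambda in bZ of chi_[0,c)(t - mu + lambda) x(lambda). Only the (finitely many)
  nonzero terms are summed.\<close>
definition M_row :: "real \<Rightarrow> real \<Rightarrow> real \<Rightarrow> real \<Rightarrow> (int \<Rightarrow> real) \<Rightarrow> int \<Rightarrow> real" where
  "M_row a b c t x m =
     (\<Sum>k\<in>{k::int. 0 \<le> t - of_int m * a + of_int k * b \<and> t - of_int m * a + of_int k * b < c}.
        indicator {0..<c} (t - of_int m * a + of_int k * b) * x k)"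

definition S_set :: "real \<Rightarrow> real \<Rightarrow> real \<Rightarrow> real set" where
  "S_set a b c = {t. \<exists>x::int \<Rightarrow> real. (\<forall>k. x k \<in> {0, 1}) \<and> x 0 = 1 \<and>
                       (\<forall>m::int. M_row a b c t x m = 1)}"

definition lat_gcd :: "real \<Rightarrow> real \<Rightarrow> real \<Rightarrow> real" where
  "lat_gcd h x y = (GREATEST d. in_lat d h \<and> d > 0 \<and> in_lat x d \<and> in_lat y d)"

end

theory Submission
  imports Defs
begin

text \<open>
  In units of \<open>b / q\<close> all data are integers, and a solution of \<open>M x = 1\<close> is a set of points in a coset
  of \<open>b \<int>\<close> such that every window \<open>[m a, m a + c)\<close> contains exactly one of them. The residue modulo
  \<open>a\<close> of a point determines the next point, so the question is whether the resulting partially defined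
  map on \<open>\<int> / a\<close>, which translates by \<open>c\<^sub>1 + b\<close> on \<open>[0, c\<^sub>0 + a - b)\<close>, by \<open>c\<^sub>1\<close> on \<open>[c\<^sub>0, a)\<close>, and is
  undefined on the hole between them, has an invariant set. An invariant set inside one branch is a
  union of cosets, which gives conditions 1 and 2. On a minimal invariant set meeting both branches,
  the map preserves the cyclic order, so it rotates the indices of its \<open>N\<close> points by some \<open>s\<close> coprime
  to \<open>N\<close>. It preserves the gaps between neighbours, except that the gap containing the hole shrinks by
  \<open>b - a\<close> and the gap across \<open>0\<close> grows by \<open>b - a\<close>. Hence there are only two gap lengths, the long gaps
  form one stretch of an orbit of the rotation, and condition 3 records this pattern: of the long
  gaps other than the one containing the hole, \<open>d\<^sub>1\<close> lie to the left of the hole and \<open>d\<^sub>2\<close> to its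
  right, and \<open>d\<^sub>3\<close>, \<open>d\<^sub>4\<close> count the short gaps likewise, except for the one across \<open>0\<close>.
\<close>

section \<open>Integer-indexed sequences\<close>

text \<open>Iterates of \<open>f\<close> and of a right inverse of \<open>f\<close> on
  \<open>Y\<close> are glued at index 0; surjectivity lets the orbit run into the past.\<close>

lemma bi_infinite_orbit:
  assumes onto: "f ` Y = Y" and y0: "y0 \<in> Y"
  obtains y :: "int \<Rightarrow> 'a"
  where "y 0 = y0" and "\<And>i. y i \<in> Y" and "\<And>i. y (i + 1) = f (y i)"
proof -
  define g where "g = inv_into Y f"
  have g: "g x \<in> Y" "f (g x) = x" if "x \<in> Y" for x
    using that onto by (auto simp: g_def inv_into_into f_inv_into_f)
  have f: "f x \<in> Y" if "x \<in> Y" for x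
    using that onto by blast
  have fn: "(f ^^ n) y0 \<in> Y" and gn: "(g ^^ n) y0 \<in> Y" for n
    by (induction n) (auto simp: y0 f g)
  define y where "y i = (if 0 \<le> i then (f ^^ nat i) y0 else (g ^^ nat (- i)) y0)" for i
  show ?thesis
  proof
    show "y 0 = y0" by (simp add: y_def)
    show "y i \<in> Y" for i by (simp add: y_def fn gn)
    show "y (i + 1) = f (y i)" for i
    proof (cases "0 \<le> i")
      case True
      then have "nat (i + 1) = Suc (nat i)" by simp
      with True show ?thesis by (simp add: y_def)
    next
      case False
      then have "nat (- i) = Suc (nat (- (i + 1)))" by simp
      with False have "f (y i) = (g ^^ nat (- (i + 1))) y0"
        by (simp add: y_def g gn del: nat_minus_as_int)
      with False show ?thesis by (cases "i = - 1") (auto simp: y_def)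
    qed
  qed
qed

lemma add_multiple_of_quasi_period:
  fixes f :: "int \<Rightarrow> int"
  assumes "\<And>j. f (j + s) = f j + k"
  shows "f (j + u * s) = f j + u * k"
proof (induction u rule: int_induct[where k = 0])
  case base
  show ?case by simp
next
  case (step1 i)
  have "f (j + (i + 1) * s) = f ((j + i * s) + s)" by (simp add: algebra_simps)
  also have "\<dots> = f j + (i + 1) * k" unfolding assms using step1 by (simp add: algebra_simps)
  finally show ?case .
next
  case (step2 i)
  have "f (j + i * s) = f ((j + (i - 1) * s) + s)" by (simp add: algebra_simps)
  then show ?case unfolding assms using step2 by (simp add: algebra_simps)
qed

text \<open>By Bezout, 1 is an integer combination of \<open>s\<close> and \<open>N\<close>, so a
  step by 1 also changes \<open>f\<close> by a constant.\<close>

lemma coprime_quasi_periods_imp_affine: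
  fixes f :: "int \<Rightarrow> int"
  assumes s: "\<And>j. f (j + s) = f j + k" and N: "\<And>j. f (j + N) = f j + l"
    and "coprime s N"
  obtains g where "\<And>j. f j = f 0 + j * g"
proof -
  obtain u v where uv: "u * s + v * N = 1"
    using bezout_int[of s N] \<open>coprime s N\<close> by (auto simp: coprime_iff_gcd_eq_1)
  have "f (j + 1) = f j + (u * k + v * l)" for j
  proof -
    have "f (j + 1) = f ((j + u * s) + v * N)" by (simp add: add.assoc uv)
    also have "\<dots> = f j + (u * k + v * l)"
      by (simp add: add_multiple_of_quasi_period[of f, OF N]
          add_multiple_of_quasi_period[of f, OF s])
    finally show ?thesis .
  qed
  from add_multiple_of_quasi_period[of f, OF this, of 0 _]
  have "f j = f 0 + j * (u * k + v * l)" for j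
    by (metis add_0 mult.right_neutral)
  then show ?thesis by (rule that)
qed

lemma increasing_int_seq_ge:
  fixes e :: "int \<Rightarrow> int"
  assumes "\<And>i. e i < e (i + 1)" and "i \<le> j"
  shows "e i + (j - i) \<le> e j"
  using \<open>i \<le> j\<close>
proof (induction j rule: int_ge_induct)
  case (step j)
  then show ?case using assms(1)[of j] by simp
qed simp

lemma increasing_int_seq_less_iff:
  fixes e :: "int \<Rightarrow> int"
  assumes "\<And>i. e i < e (i + 1)"
  shows "e i < e j \<longleftrightarrow> i < j"
  using increasing_int_seq_ge[of e i j, OF assms] increasing_int_seq_ge[of e j i, OF assms]
  by (cases "i < j") auto

text \<open>A strictly increasing integer sequence grows at least linearly in both directions, so
  the half-open intervals between consecutive terms partition the integers.\<close>

lemma increasing_int_seq_bracket: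
  fixes e :: "int \<Rightarrow> int"
  assumes inc: "\<And>i. e i < e (i + 1)"
  shows "\<exists>!i. e i \<le> m \<and> m < e (i + 1)"
proof -
  define b where "b = \<bar>m\<bar> + \<bar>e 0\<bar> + 1"
  define I where "I = {i \<in> {- b..b}. e i \<le> m}"
  have "e (- b) \<le> m" "m < e b"
    using increasing_int_seq_ge[of e "- b" 0, OF inc] increasing_int_seq_ge[of e 0 b, OF inc]
    by (auto simp: b_def abs_if split: if_splits)
  then have "- b \<in> I" by (auto simp: I_def b_def)
  moreover have "finite I" by (rule finite_subset[of _ "{- b..b}"]) (auto simp: I_def)
  ultimately have I: "finite I" "I \<noteq> {}" by auto
  define i where "i = Max I"
  have i: "i \<in> I" "\<And>j. j \<in> I \<Longrightarrow> j \<le> i"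
    using I by (auto simp: i_def)
  have "i < b"
    using i(1) \<open>m < e b\<close> increasing_int_seq_less_iff[of e, OF inc] by (auto simp: I_def less_le)
  then have "m < e (i + 1)"
    using i(1) i(2)[of "i + 1"] unfolding I_def by (auto simp: not_le[symmetric])
  show ?thesis
  proof (rule ex1I)
    show "e i \<le> m \<and> m < e (i + 1)"
      using i \<open>m < e (i + 1)\<close> by (auto simp: I_def)
  next
    fix j assume j: "e j \<le> m \<and> m < e (j + 1)"
    have "e j < e (i + 1)" "e i < e (j + 1)"
      using j i(1) \<open>m < e (i + 1)\<close> by (auto simp: I_def)
    then show "j = i"
      unfolding increasing_int_seq_less_iff[of e, OF inc] by simp
  qed
qed

text \<open>Periodicity gives every element a next and a previous one within distance
  \<open>p\<close>, so the successor map is onto \<open>Y\<close>. Its two-sided orbit through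
  \<open>y0\<close> is the enumeration, and bracketing shows that nothing is skipped.\<close>

lemma enumerate_periodic_int_set:
  fixes Y :: "int set"
  assumes p: "0 < p" and per: "\<And>y. y + p \<in> Y \<longleftrightarrow> y \<in> Y" and y0: "y0 \<in> Y"
  obtains \<pi> :: "int \<Rightarrow> int"
  where "\<pi> 0 = y0" and "\<And>i. \<pi> i < \<pi> (i + 1)" and "range \<pi> = Y"
proof -
  define succs where "succs y = {z \<in> Y. y < z \<and> z \<le> y + p}" for y
  define nx where "nx y = Min (succs y)" for y
  have fin: "finite (succs y)" for y
    by (rule finite_subset[of _ "{y..y + p}"]) (auto simp: succs_def)
  have nx: "nx y \<in> succs y" if "y \<in> Y" for y
  proof -
    have "y + p \<in> succs y" using that per p by (auto simp: succs_def)
    then show ?thesis unfolding nx_def using fin by (intro Min_in) auto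
  qed
  have nx_le: "nx y \<le> z" if "z \<in> succs y" for y z
    unfolding nx_def using fin that by simp
  have "nx ` Y = Y"
  proof
    show "nx ` Y \<subseteq> Y" using nx by (auto simp: succs_def)
    show "Y \<subseteq> nx ` Y"
    proof
      fix z assume z: "z \<in> Y"
      define preds where "preds = {y \<in> Y. z - p \<le> y \<and> y < z}"
      have "finite preds"
        by (rule finite_subset[of _ "{z - p..z}"]) (auto simp: preds_def)
      moreover have "z - p \<in> preds" using z p per[of "z - p"] by (auto simp: preds_def)
      ultimately have y: "Max preds \<in> preds" and le: "\<And>x. x \<in> preds \<Longrightarrow> x \<le> Max preds"
        by (auto intro: Max_in)
      let ?y = "Max preds"
      have zs: "z \<in> succs ?y" using y z by (auto simp: preds_def succs_def)
      have "nx ?y = z"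
      proof (rule ccontr)
        assume "nx ?y \<noteq> z"
        then have "nx ?y < z" using nx_le[OF zs] by simp
        moreover have "nx ?y \<in> succs ?y" using nx y by (auto simp: preds_def)
        ultimately have "nx ?y \<in> preds" using y by (auto simp: preds_def succs_def)
        then show False using le \<open>nx ?y \<in> succs ?y\<close> by (force simp: succs_def)
      qed
      moreover have "?y \<in> Y" using y by (simp add: preds_def)
      ultimately show "z \<in> nx ` Y" by (metis imageI)
    qed
  qed
  then obtain \<pi> :: "int \<Rightarrow> int" where \<pi>: "\<pi> 0 = y0" "\<And>i. \<pi> i \<in> Y" "\<And>i. \<pi> (i + 1) = nx (\<pi> i)"
    using bi_infinite_orbit[OF _ y0] by blast
  have inc: "\<pi> i < \<pi> (i + 1)" for i
    using nx[OF \<pi>(2)] unfolding \<pi>(3) by (auto simp: succs_def)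
  have "y \<in> range \<pi>" if "y \<in> Y" for y
  proof -
    obtain i where i: "\<pi> i \<le> y" "y < \<pi> (i + 1)"
      using increasing_int_seq_bracket[of \<pi> y, OF inc] by auto
    have le: "\<pi> (i + 1) \<le> \<pi> i + p"
      using nx[OF \<pi>(2)[of i]] by (simp add: \<pi>(3)[of i] succs_def)
    have "\<not> \<pi> i < y"
    proof
      assume "\<pi> i < y"
      then have "y \<in> succs (\<pi> i)"
        using i(2) le \<open>y \<in> Y\<close> unfolding succs_def by simp
      from nx_le[OF this] i(2) show False by (simp add: \<pi>(3)[of i])
    qed
    then have "y = \<pi> i" using i(1) by simp
    then show ?thesis by simp
  qed
  then have "range \<pi> = Y" using \<pi>(2) by blast
  then show ?thesis using that \<pi> inc by blast
qed

text \<open>Consecutive points go to consecutive points: a point skipped between their images would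
  need a preimage strictly between them. Hence the induced index map has increment 1.\<close>

lemma increasing_surjection_is_shift:
  fixes \<pi> :: "int \<Rightarrow> int"
  assumes inc: "\<And>i. \<pi> i < \<pi> (i + 1)"
    and onto: "\<phi> ` range \<pi> = range \<pi>"
    and mono: "\<And>x y. x \<in> range \<pi> \<Longrightarrow> y \<in> range \<pi> \<Longrightarrow> x < y \<Longrightarrow> \<phi> x < \<phi> y"
  obtains s where "\<And>i. \<phi> (\<pi> i) = \<pi> (i + s)"
proof -
  note less_iff = increasing_int_seq_less_iff[of \<pi>, OF inc]
  have "\<exists>k. \<phi> (\<pi> i) = \<pi> k" for i
    using onto by blast
  then obtain \<sigma> where \<sigma>: "\<And>i. \<phi> (\<pi> i) = \<pi> (\<sigma> i)" by metis
  have \<phi>_less: "\<phi> (\<pi> i) < \<phi> (\<pi> j) \<longleftrightarrow> i < j" for i j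
    using mono[of "\<pi> i" "\<pi> j"] mono[of "\<pi> j" "\<pi> i"] less_iff[of i j] less_iff[of j i]
    by (metis linorder_neqE order_less_asym rangeI)
  have "\<sigma> (i + 1) = \<sigma> i + 1" for i
  proof -
    have "\<pi> (\<sigma> i + 1) \<in> \<phi> ` range \<pi>"
      using onto by simp
    then obtain j where j: "\<pi> (\<sigma> i + 1) = \<phi> (\<pi> j)" by blast
    have "\<sigma> i < \<sigma> (i + 1)"
      using \<phi>_less[of i "i + 1"] by (simp add: \<sigma> less_iff)
    moreover have "i < j"
      using j inc[of "\<sigma> i"] \<phi>_less[of i j] by (simp add: \<sigma>)
    then have "\<not> \<phi> (\<pi> j) < \<phi> (\<pi> (i + 1))" by (simp add: \<phi>_less)
    then have "\<not> \<sigma> i + 1 < \<sigma> (i + 1)"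
      unfolding \<sigma>[of "i + 1"] j[symmetric] less_iff .
    ultimately show ?thesis by simp
  qed
  from add_multiple_of_quasi_period[of \<sigma>, OF this, of 0 _] have "\<sigma> i = i + \<sigma> 0" for i
    by (metis add_0 mult.right_neutral add.commute)
  with \<sigma> that show ?thesis by metis
qed

section \<open>Counting multiples in residue intervals\<close>

text \<open>The signed number of pairs \<open>(i, n)\<close> with \<open>0 < i \<le> j\<close>, \<open>1 \<le> n \<le> K\<close> and
  \<open>i \<equiv> n s (mod N)\<close>. Written with floor divisions, it makes sense for every integer \<open>j\<close>,
  and shifting \<open>j\<close> by \<open>s\<close> telescopes.\<close>
definition hits :: "int \<Rightarrow> int \<Rightarrow> int \<Rightarrow> int \<Rightarrow> int" where
  "hits N s K j = (\<Sum>n\<in>{1..K}. (j - n * s) div N - (- (n * s)) div N)"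

lemma hits_0 [simp]: "hits N s K 0 = 0"
  by (simp add: hits_def)

lemma hits_add_period:
  assumes "0 < N" and "0 \<le> K"
  shows "hits N s K (j + N) = hits N s K j + K"
proof -
  have "(j + N - n * s) div N = (j - n * s) div N + 1" for n
    using div_add_self2[of N "j - n * s"] \<open>0 < N\<close> by (simp add: algebra_simps)
  then have "hits N s K (j + N) = (\<Sum>n\<in>{1..K}. ((j - n * s) div N - (- (n * s)) div N) + 1)"
    by (simp add: hits_def algebra_simps)
  then show ?thesis
    using \<open>0 \<le> K\<close> by (simp add: hits_def sum.distrib del: sum_subtractf)
qed

text \<open>Replacing \<open>j\<close> by \<open>j + s\<close> turns the \<open>n\<close>-th floor
  into the one for \<open>n - 1\<close>, so only the end terms for \<open>0\<close> and
  \<open>K\<close> survive.\<close>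

lemma hits_add_shift:
  assumes "0 \<le> K"
  shows "hits N s K (j + s) = hits N s K j + j div N - (j - K * s) div N"
  using assms
proof (induction K rule: int_ge_induct)
  case base
  show ?case by (simp add: hits_def)
next
  case (step K)
  have "{1..K + 1} = insert (K + 1) {1..K}" using step.hyps by auto
  then have "hits N s (K + 1) i = (i - (K + 1) * s) div N - (- ((K + 1) * s)) div N + hits N s K i" for i
    by (simp add: hits_def)
  moreover have "(j + s - (K + 1) * s) div N = (j - K * s) div N" by (simp add: algebra_simps)
  ultimately show ?case using step.IH by simp
qed

text \<open>For \<open>j\<close> within one period, the \<open>n\<close>-th summand is 1 if the
  residue of \<open>n * s\<close> lies in \<open>(0, j]\<close> and 0 otherwise.\<close>

lemma hits_eq_card:
  assumes "0 \<le> j" and "j < N"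
  shows "hits N s K j = int (card {n \<in> {1..K}. 0 < (n * s) mod N \<and> (n * s) mod N \<le> j})"
proof -
  have "(j - m) div N - (- m) div N = (if 0 < m mod N \<and> m mod N \<le> j then 1 else 0)" for m
  proof -
    define r where "r = m mod N"
    have r: "0 \<le> r" "r < N" using assms by (auto simp: r_def)
    have "(x - m) div N = (x - r) div N - m div N" for x
    proof -
      have "x - m = (x - r) + (- (m div N)) * N"
        by (simp add: r_def minus_div_mult_eq_mod[symmetric] algebra_simps)
      then have "(x - m) div N = ((x - r) + (- (m div N)) * N) div N" by (rule arg_cong)
      also have "\<dots> = (x - r) div N - m div N"
        using assms by (subst div_mult_self1) auto
      finally show ?thesis .
    qed
    from this[of j] this[of 0]
    have "(j - m) div N - (- m) div N = (j - r) div N - (- r) div N" by simp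
    moreover have "(x - r) div N = (if r \<le> x then 0 else - 1)" if "0 \<le> x" "x < N" for x
    proof (cases "r \<le> x")
      case True
      then show ?thesis using that r by simp
    next
      case False
      then have "(x - r) div N = - 1" using that r by (intro int_div_pos_eq[of _ _ _ "x - r + N"]) auto
      then show ?thesis using False by simp
    qed
    from this[of j] this[of 0]
    have "(j - r) div N - (- r) div N = (if 0 < r \<and> r \<le> j then 1 else 0)"
      using r assms by auto
    ultimately show ?thesis by (simp add: r_def)
  qed
  then have "hits N s K j = (\<Sum>n\<in>{1..K}. if 0 < (n * s) mod N \<and> (n * s) mod N \<le> j then 1 else 0)"
    unfolding hits_def by simp
  then show ?thesis by (simp add: Int_def sum.If_cases)
qed

lemma coprime_mult_mod_pos:
  fixes n s N :: int
  assumes "coprime s N" and "0 < n" and "n < N"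
  shows "0 < (n * s) mod N"
proof -
  have "\<not> N dvd n * s"
    using assms zdvd_imp_le[of N n] by (auto simp: coprime_dvd_mult_left_iff coprime_commute)
  moreover have "0 \<le> (n * s) mod N" using assms by simp
  ultimately show ?thesis by (auto simp: order_less_le dvd_eq_mod_eq_0)
qed

text \<open>Coprimality makes all \<open>K\<close> residues nonzero, so the count at
  \<open>N - 1\<close> is \<open>K\<close>, and going back one period leaves 0. On the circle this
  says that no long gap ends at index 0.\<close>

lemma hits_neg_1:
  assumes "coprime s N" and "0 < N" and "0 \<le> K" and "K < N"
  shows "hits N s K (- 1) = 0"
proof -
  have "{n \<in> {1..K}. 0 < (n * s) mod N \<and> (n * s) mod N \<le> N - 1} = {1..K}"
  proof -
    have "0 < (n * s) mod N" if "n \<in> {1..K}" for n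
      using that assms by (intro coprime_mult_mod_pos) auto
    moreover have "(n * s) mod N \<le> N - 1" for n
      using \<open>0 < N\<close> by simp
    ultimately show ?thesis by blast
  qed
  then have "hits N s K (N - 1) = K"
    using hits_eq_card[of "N - 1" N s K] assms by simp
  then show ?thesis using hits_add_period[of N K s "- 1"] assms by simp
qed

section \<open>A circle map with two branches and a hole\<close>

text \<open>In units of \<open>b / q\<close> we have \<open>a = p\<close>, \<open>b = p + D\<close>, \<open>c\<^sub>0 = z0\<close> and \<open>c\<^sub>1 = z1\<close>. Passing to the
  successor of a point of a tiling set acts on residues modulo \<open>p\<close> by a translation on each of the
  two branches \<open>[0, z0 - D)\<close> and \<open>[z0, p)\<close>; it is undefined on the hole between them.\<close>
locale two_branch =
  fixes p D z0 z1 :: int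
  assumes D_pos: "0 < D" and D_less: "D < z0" and z0_less: "z0 < p"
begin

definition invariant :: "int set \<Rightarrow> bool" where
  "invariant Q \<longleftrightarrow> Q \<noteq> {} \<and> Q \<subseteq> {0..<p} \<and>
     (\<forall>r\<in>Q. r < z0 - D \<and> (r + z1 + D) mod p \<in> Q \<or> z0 \<le> r \<and> (r + z1) mod p \<in> Q)"

section \<open>Lifting the partial map to the integers\<close>

definition lift_set :: "int set \<Rightarrow> int set" where
  "lift_set Q = {y. y mod p \<in> Q}"

text \<open>Two choices of representatives modulo \<open>p\<close> are used: \<open>z1 + D\<close>
  and \<open>z1\<close> preserve the order, while multiples of \<open>p + D\<close> keep an orbit in
  one coset. On the hole \<open>\<beta>\<close> is a default value, never met on the lift of an
  invariant set.\<close>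

definition lift_step :: "int \<Rightarrow> int \<Rightarrow> int \<Rightarrow> int" where
  "lift_step \<alpha> \<beta> y = y + (if y mod p < z0 - D then \<alpha> else \<beta>)"

lemma p_pos: "0 < p"
  using D_pos D_less z0_less by simp

lemma invariant_cases:
  assumes "invariant Q" and "r \<in> Q"
  obtains "0 \<le> r" "r < z0 - D" "r < p" "(r + z1 + D) mod p \<in> Q"
    | "z0 \<le> r" "0 \<le> r" "r < p" "\<not> r < z0 - D" "(r + z1) mod p \<in> Q"
  using assms D_pos D_less z0_less unfolding invariant_def by fastforce

lemma finite_invariant: "invariant Q \<Longrightarrow> finite Q"
  using finite_subset[of Q "{0..<p}"] by (auto simp: invariant_def)

text \<open>Up to the common translation by \<open>z1\<close>, the branches land in the disjoint
  intervals \<open>[D, z0)\<close> and \<open>[z0, p)\<close>. So the residue map is injective on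
  the finite set \<open>Q\<close>, hence onto, and preimages lift.\<close>

lemma lift_step_onto:
  assumes Q: "invariant Q" and \<alpha>: "\<alpha> mod p = (z1 + D) mod p" and \<beta>: "\<beta> mod p = z1 mod p"
  shows "lift_step \<alpha> \<beta> ` lift_set Q = lift_set Q"
proof -
  define R where "R r = (if r < z0 - D then (r + z1 + D) mod p else (r + z1) mod p)" for r
  have R_mod: "lift_step \<alpha> \<beta> y mod p = R (y mod p)" for y
    using mod_add_cong[OF refl[of "y mod p"] \<alpha>] mod_add_cong[OF refl[of "y mod p"] \<beta>]
    by (simp add: lift_step_def R_def add.assoc mod_simps)
  have "R ` Q \<subseteq> Q"
    using Q by (auto simp: R_def elim: invariant_cases)
  moreover have "inj_on R Q"
  proof (rule inj_onI)
    fix r r' assume r: "r \<in> Q" "r' \<in> Q" and eq: "R r = R r'"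
    have close: "x = y" if "(x + z) mod p = (y + z) mod p" "\<bar>x - y\<bar> < p" for x y z :: int
    proof -
      have "p dvd x - y" using that(1) by (metis add_diff_cancel_right mod_eq_dvd_iff)
      then show ?thesis using that(2) p_pos dvd_imp_le_int[of "x - y" p] by force
    qed
    from Q r(1) show "r = r'"
    proof (cases rule: invariant_cases)
      case 1
      note left = 1
      from Q r(2) show ?thesis
      proof (cases rule: invariant_cases)
        case 1
        then show ?thesis using left eq close[of r "z1 + D" r'] by (simp add: R_def add.assoc)
      next
        case 2
        then show ?thesis using left eq close[of "r + D" z1 r'] D_pos
          by (simp add: R_def algebra_simps)
      qed
    next
      case 2
      note right = 2
      from Q r(2) show ?thesis
      proof (cases rule: invariant_cases)
        case 1
        then show ?thesis using right eq close[of r z1 "r' + D"] D_pos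
          by (simp add: R_def algebra_simps)
      next
        case 2
        then show ?thesis using right eq close[of r z1 r'] by (simp add: R_def)
      qed
    qed
  qed
  ultimately have RQ: "R ` Q = Q"
    using finite_invariant[OF Q] by (simp add: endo_inj_surj)
  show ?thesis
  proof
    show "lift_step \<alpha> \<beta> ` lift_set Q \<subseteq> lift_set Q"
      using RQ R_mod by (auto simp: lift_set_def)
    show "lift_set Q \<subseteq> lift_step \<alpha> \<beta> ` lift_set Q"
    proof
      fix y assume "y \<in> lift_set Q"
      then obtain r where r: "r \<in> Q" "y mod p = R r"
        using RQ by (auto simp: lift_set_def)
      define x where "x = y - (if r < z0 - D then \<alpha> else \<beta>)"
      have "r mod p = r"
        using Q r(1) by (auto elim: invariant_cases)
      moreover have "x mod p = r mod p"
      proof (cases "r < z0 - D")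
        case True
        have "x mod p = (y mod p - \<alpha> mod p) mod p" using True by (simp add: x_def mod_simps)
        also have "\<dots> = (r + z1 + D - (z1 + D)) mod p"
          unfolding r(2) \<alpha> using True by (simp only: R_def if_True mod_simps)
        finally show ?thesis by simp
      next
        case False
        have "x mod p = (y mod p - \<beta> mod p) mod p" using False by (simp add: x_def mod_simps)
        also have "\<dots> = (r + z1 - z1) mod p"
          unfolding r(2) \<beta> using False by (simp only: R_def if_False mod_simps)
        finally show ?thesis by simp
      qed
      ultimately have "x mod p = r" by simp
      then have "y = lift_step \<alpha> \<beta> x" "x \<in> lift_set Q"
        using r(1) by (auto simp: lift_step_def lift_set_def x_def)
      then show "y \<in> lift_step \<alpha> \<beta> ` lift_set Q" by blast
    qed
  qed
qed

text \<open>The order could fail only for \<open>x\<close> on the left and \<open>y\<close> on the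
  right branch, where \<open>x\<close> gains \<open>D\<close> on \<open>y\<close>; but then the hole
  of width \<open>D\<close> lies between them.\<close>

lemma lift_step_strict_mono:
  assumes Q: "invariant Q" and "x \<in> lift_set Q" "y \<in> lift_set Q" "x < y"
  shows "lift_step (z1 + D) z1 x < lift_step (z1 + D) z1 y"
proof -
  have le: "x div p \<le> y div p" using \<open>x < y\<close> p_pos by (simp add: zdiv_mono1)
  have "x + D < y" if "x mod p < z0 - D" "z0 \<le> y mod p"
  proof -
    have "p * (x div p) \<le> p * (y div p)" using le p_pos by simp
    then show ?thesis using that mult_div_mod_eq[of p x] mult_div_mod_eq[of p y] by linarith
  qed
  moreover have "x mod p < z0 - D \<or> z0 \<le> x mod p" "y mod p < z0 - D \<or> z0 \<le> y mod p"
    using assms by (auto simp: invariant_def lift_set_def)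
  ultimately show ?thesis
    using \<open>x < y\<close> D_pos by (auto simp: lift_step_def)
qed

text \<open>\<open>N\<close> points on the circle of length \<open>p\<close>, with \<open>K\<close> gaps of length \<open>G + D\<close> and \<open>N - K\<close> gaps of
  length \<open>G\<close>, on which the map acts as the rotation of indices by \<open>s\<close>; \<open>L\<close> of the points lie on the
  left branch, and \<open>d\<close> long gaps separate points of the left branch.\<close>
definition gap_pattern :: "int \<Rightarrow> int \<Rightarrow> int \<Rightarrow> int \<Rightarrow> int \<Rightarrow> int \<Rightarrow> bool" where
  "gap_pattern N K L d G s \<longleftrightarrow>
     0 < K \<and> K < N \<and> 0 < L \<and> L < N \<and> 0 < G \<and> p = N * G + K * D \<and> s * p = N * z1 + L * D \<and>
     N dvd K * s - L \<and> \<bar>z0 - (d + 1) * D - L * G\<bar> < G \<and> coprime s N \<and>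
     int (card {n \<in> {1..K}. 0 < (n * s) mod N \<and> (n * s) mod N < L}) = d"

section \<open>From gap patterns to invariant sets\<close>

lemma hits_add_shift_branch:
  assumes "0 \<le> K" and e: "K * s = L + e * N" and "0 \<le> j" "j < N" "0 < L" "L < N"
  shows "hits N s K (j + s) = hits N s K j + e + (if j < L then 1 else 0)"
proof -
  \<comment> \<open>As \<open>K * s\<close> is congruent to \<open>L\<close>, the end term of the
    telescoped sum detects whether \<open>j < L\<close>. This is the source of the extra
    \<open>D\<close> on the left branch.\<close>
  have "(j - K * s) div N = (j - L + (- e) * N) div N"
    by (simp add: e algebra_simps)
  also have "\<dots> = (j - L) div N - e"
    using assms by (subst div_mult_self1) auto
  also have "(j - L) div N = (if j < L then - 1 else 0)"
    using assms int_div_pos_eq[of "j - L" N "- 1" "j - L + N"] by auto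
  finally show ?thesis
    using hits_add_shift[OF \<open>0 \<le> K\<close>, of N s j] assms by simp
qed

lemma gap_pattern_imp_invariant:
  assumes "gap_pattern N K L d G s"
  shows "\<exists>Q. invariant Q"
proof -
  have K: "0 < K" "K < N" and L: "0 < L" "L < N" and G: "0 < G" and p: "p = N * G + K * D"
    and s: "s * p = N * z1 + L * D" and "N dvd K * s - L"
    and \<delta>: "\<bar>z0 - (d + 1) * D - L * G\<bar> < G"
    and d: "int (card {n \<in> {1..K}. 0 < (n * s) mod N \<and> (n * s) mod N < L}) = d"
    using assms unfolding gap_pattern_def by blast+
  then obtain e where e: "K * s = L + e * N"
    by (auto simp: dvd_def algebra_simps)
  define H where "H j = {n \<in> {1..K}. 0 < (n * s) mod N \<and> (n * s) mod N \<le> j}" for j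
  have H: "hits N s K j = int (card (H j))" if "0 \<le> j" "j < N" for j
    using that by (simp add: hits_eq_card H_def)
  have finH: "finite (H j)" for j
    by (rule finite_subset[of _ "{1..K}"]) (auto simp: H_def)
  have mono: "hits N s K i \<le> hits N s K j" if "0 \<le> i" "i \<le> j" "j < N" for i j
    using that card_mono[OF finH, of "H i" j] by (force simp: H H_def)
  have HL1: "hits N s K (L - 1) = d"
    using H[of "L - 1"] L d by (simp add: H_def)
  have HL: "d + 1 \<le> hits N s K L"
  proof -
    \<comment> \<open>The index \<open>n = K\<close> is counted at \<open>L\<close> but not at
      \<open>L - 1\<close>: the gap containing the hole is long.\<close>
    have "(K * s) mod N = L" using e L by simp
    then have "insert K (H (L - 1)) \<subseteq> H L" "K \<notin> H (L - 1)"
      using K L by (auto simp: H_def)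
    then have "card (H (L - 1)) + 1 \<le> card (H L)"
      using card_mono[OF finH, of "insert K (H (L - 1))" L] finH by simp
    then show ?thesis using H[of L] H[of "L - 1"] L HL1 by simp
  qed
  have HN: "hits N s K (N - 1) \<le> K"
  proof -
    have "card (H (N - 1)) \<le> card {1..K}" by (rule card_mono) (auto simp: H_def)
    then show ?thesis using H[of "N - 1"] K by simp
  qed
  \<comment> \<open>With \<open>w = z0 - (d + 1) * D - L * G\<close>, the branch conditions hold if
    the first point lies in both \<open>[0, G)\<close> and \<open>[w, w + G)\<close>. These
    intervals meet because \<open>\<bar>w\<bar> < G\<close>, and the larger of their left ends is in
    both.\<close>
  define \<pi>0 where "\<pi>0 = max 0 (z0 - (d + 1) * D - L * G)"
  define \<pi> where "\<pi> j = \<pi>0 + j * G + D * hits N s K j" for j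
  have \<pi>_mono: "\<pi> i \<le> \<pi> j" if "0 \<le> i" "i \<le> j" "j < N" for i j
    using mono[OF that] that G D_pos by (auto simp: \<pi>_def intro!: add_mono)
  have ends: "0 \<le> \<pi> 0" "\<pi> (L - 1) < z0 - D"
    using \<delta> by (simp_all add: \<pi>_def \<pi>0_def HL1 algebra_simps)
  have ends': "z0 \<le> \<pi> L"
  proof -
    have "D * (d + 1) \<le> D * hits N s K L" using HL D_pos by simp
    then show ?thesis by (simp add: \<pi>_def \<pi>0_def algebra_simps)
  qed
  have ends'': "\<pi> (N - 1) < p"
  proof -
    have "D * hits N s K (N - 1) \<le> D * K" using HN D_pos by simp
    then show ?thesis using \<delta> G by (simp add: \<pi>_def \<pi>0_def p algebra_simps)
  qed
  have left: "0 \<le> \<pi> j \<and> \<pi> j < z0 - D" if "0 \<le> j" "j < L" for j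
    using \<pi>_mono[of 0 j] \<pi>_mono[of j "L - 1"] L that ends by simp
  have right: "z0 \<le> \<pi> j \<and> \<pi> j < p" if "L \<le> j" "j < N" for j
    using \<pi>_mono[of L j] \<pi>_mono[of j "N - 1"] L that ends' ends'' by simp
  define Q where "Q = \<pi> ` {0..<N}"
  have Q: "Q \<noteq> {}" "Q \<subseteq> {0..<p}"
  proof -
    show "Q \<noteq> {}" using L by (auto simp: Q_def)
    show "Q \<subseteq> {0..<p}"
    proof
      fix r assume "r \<in> Q"
      then obtain j where "r = \<pi> j" "0 \<le> j" "j < N" by (auto simp: Q_def)
      then show "r \<in> {0..<p}"
        using left[of j] right[of j] D_pos D_less z0_less by (cases "j < L") auto
    qed
  qed
  have "\<pi> (j + N) = \<pi> j + p" for j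
    using K hits_add_period[of N K s j] by (simp add: \<pi>_def p algebra_simps)
  note \<pi>_period = add_multiple_of_quasi_period[of \<pi>, OF this]
  have mem: "\<pi> j mod p \<in> Q" for j
  proof -
    have "\<pi> j = \<pi> (j mod N) + (j div N) * p"
      using \<pi>_period[of "j mod N" "j div N"] by simp
    moreover have "\<pi> (j mod N) \<in> Q" using L by (auto simp: Q_def)
    ultimately show ?thesis using Q(2) by auto
  qed
  \<comment> \<open>An index shift by \<open>s\<close> adds \<open>s * G\<close> plus
    \<open>D\<close> times the change of \<open>hits\<close>; for this value of \<open>z1\<close>
    that is exactly the translation of the branch.\<close>
  have z1: "z1 = s * G + e * D"
  proof -
    have "N * z1 = s * (N * G + K * D) - L * D" using s p by simp
    also have "\<dots> = N * (s * G) + (K * s - L) * D" by (simp add: algebra_simps)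
    also have "\<dots> = N * (s * G + e * D)" by (simp add: e algebra_simps)
    finally show ?thesis using L by simp
  qed
  have step: "\<pi> (j + s) = \<pi> j + z1 + (if j < L then D else 0)" if "0 \<le> j" "j < N" for j
    using hits_add_shift_branch[OF _ e that L] K
    by (simp add: \<pi>_def z1 algebra_simps)
  have "r < z0 - D \<and> (r + z1 + D) mod p \<in> Q \<or> z0 \<le> r \<and> (r + z1) mod p \<in> Q"
    if r: "r \<in> Q" for r
  proof -
    obtain j where j: "r = \<pi> j" "0 \<le> j" "j < N" using r by (auto simp: Q_def)
    then show ?thesis
      using left[of j] right[of j] step[of j] mem[of "j + s"] by (cases "j < L") auto
  qed
  with Q have "invariant Q" by (simp add: invariant_def)
  then show ?thesis ..
qed

section \<open>Invariant sets inside one branch\<close>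

lemma coset_invariant_right:
  assumes "z0 < gcd p z1"
  shows "\<exists>Q. invariant Q"
proof -
  define g where "g = gcd p z1"
  have g: "0 < g" "g dvd p" "g dvd z1" using p_pos by (auto simp: g_def)
  \<comment> \<open>Since \<open>z0 < g\<close>, the least nonnegative member of the class of
    \<open>z0\<close> modulo \<open>g\<close> is \<open>z0\<close> itself, so the class stays in the
    right branch.\<close>
  define Q where "Q = {r \<in> {0..<p}. r mod g = z0}"
  have z0: "z0 mod g = z0" using assms D_pos D_less by (simp add: g_def)
  have "z0 \<in> Q" using z0 D_pos D_less z0_less by (simp add: Q_def)
  moreover have "z0 \<le> r" "(r + z1) mod p \<in> Q" if "r \<in> Q" for r
  proof -
    have r: "0 \<le> r" "r mod g = z0" using that by (auto simp: Q_def)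
    show "z0 \<le> r" using zmod_le_nonneg_dividend[of r g] r by simp
    have "(r + z1) mod p mod g = r mod g"
      using g by (auto simp: mod_mod_cancel elim: dvdE)
    then show "(r + z1) mod p \<in> Q" using r p_pos by (simp add: Q_def)
  qed
  ultimately have "invariant Q" by (auto simp: invariant_def Q_def)
  then show ?thesis ..
qed

text \<open>The multiples of \<open>g = gcd p (z1 + D)\<close> in \<open>[0, p)\<close> are
  preserved by the left translation, and the largest of them, \<open>p - g\<close>, lies to the left
  of the hole.\<close>

lemma coset_invariant_left:
  assumes "p + D - z0 < gcd p (z1 + D)"
  shows "\<exists>Q. invariant Q"
proof -
  define g where "g = gcd p (z1 + D)"
  have g: "0 < g" "g dvd p" "g dvd z1 + D" using p_pos by (auto simp: g_def)
  have "g \<le> p" using g p_pos by (simp add: zdvd_imp_le)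
  define Q where "Q = {r \<in> {0..<p}. r mod g = 0}"
  have "0 \<in> Q" using p_pos by (simp add: Q_def)
  moreover have "r < z0 - D" "(r + z1 + D) mod p \<in> Q" if "r \<in> Q" for r
  proof -
    have r: "0 \<le> r" "r < p" "g dvd r" using that by (auto simp: Q_def)
    then have "g \<le> p - r" using g by (intro zdvd_imp_le) auto
    then show "r < z0 - D" using assms by (simp add: g_def)
    have "g dvd (r + (z1 + D)) mod p" using r g by (simp add: dvd_mod_iff)
    then show "(r + z1 + D) mod p \<in> Q" using p_pos by (simp add: Q_def add.assoc)
  qed
  ultimately have "invariant Q" by (auto simp: invariant_def Q_def)
  then show ?thesis ..
qed

text \<open>By Bezout, iterating the translation sweeps out a full class modulo
  \<open>gcd p w\<close>. Its least and greatest members give the bounds behind conditions 1 and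
  2.\<close>

lemma translate_closed_mem:
  assumes Q: "Q \<noteq> {}" and step: "\<And>r. r \<in> Q \<Longrightarrow> r \<in> {0..<p} \<and> (r + w) mod p \<in> Q"
  obtains r where "0 \<le> r" "r < gcd p w" "r \<in> Q" "p - gcd p w + r \<in> Q"
proof -
  define g where "g = gcd p w"
  have g: "0 < g" "g dvd p" using p_pos by (auto simp: g_def)
  obtain r0 where r0: "r0 \<in> Q" using Q by blast
  have iter: "(r0 + int n * w) mod p \<in> Q" for n
  proof (induction n)
    case 0
    then show ?case using step[OF r0] r0 by simp
  next
    case (Suc n)
    have "((r0 + int n * w) mod p + w) mod p = (r0 + int (Suc n) * w) mod p"
      by (simp add: mod_simps algebra_simps)
    then show ?case using step[OF Suc] by simp
  qed
  obtain u v where uv: "u * p + v * w = g" using bezout_int[of p w] by (auto simp: g_def)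
  have reach: "x \<in> Q" if x: "0 \<le> x" "x < p" "x mod g = r0 mod g" for x
  proof -
    have "g dvd x - r0" using x(3) by (simp add: mod_eq_dvd_iff)
    then obtain k where k: "x - r0 = g * k" by (auto simp: dvd_def)
    \<comment> \<open>Only forward iterates are available, so the possibly negative number
      \<open>k * v\<close> of steps is reduced modulo \<open>p\<close>.\<close>
    define n where "n = nat ((k * v) mod p)"
    have n: "int n = (k * v) mod p" using p_pos by (simp add: n_def)
    have "(r0 + int n * w) mod p = (r0 + k * v * w) mod p"
      unfolding n by (metis mod_add_right_eq mod_mult_left_eq)
    also have "r0 + k * v * w = x + (- (k * u)) * p"
      using k uv by (simp add: algebra_simps flip: uv)
    also have "(x + (- (k * u)) * p) mod p = x"
      using x by (simp only: mod_mult_self1 mod_pos_pos_trivial)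
    finally show ?thesis using iter[of n] by simp
  qed
  define r where "r = r0 mod g"
  have r: "0 \<le> r" "r < g" using g by (auto simp: r_def)
  have "g \<le> p" using g p_pos by (simp add: zdvd_imp_le)
  have "(p - g + r) mod g = r0 mod g"
    using g by (auto simp: r_def dvd_def mod_simps algebra_simps)
  then have "r \<in> Q" "p - g + r \<in> Q"
    using r \<open>g \<le> p\<close> by (auto intro!: reach simp: r_def)
  then show ?thesis using that r by (simp add: g_def)
qed

section \<open>From a minimal invariant set meeting both branches to a gap pattern\<close>

lemma invariant_imp_gap_pattern:
  assumes Q: "invariant Q" and min: "\<And>Q'. invariant Q' \<Longrightarrow> card Q \<le> card Q'"
    and rl: "rl \<in> Q" "rl < z0 - D" and rr: "rr \<in> Q" "z0 \<le> rr"
  shows "\<exists>N K L d G s. gap_pattern N K L d G s"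
proof -
  define Y where "Y = lift_set Q"
  have Q_range: "0 \<le> r" "r < p" "r mod p = r" if "r \<in> Q" for r
    using Q that by (auto simp: invariant_def)
  have Q_split: "r < z0 - D \<or> z0 \<le> r" if "r \<in> Q" for r
    using Q that by (auto simp: invariant_def)
  have QY: "r \<in> Y" if "r \<in> Q" for r
    using Q_range(3)[OF that] that by (simp add: Y_def lift_set_def)
  have Y_Q: "y \<in> Q" if "y \<in> Y" "0 \<le> y" "y < p" for y
    using that by (simp add: Y_def lift_set_def)
  have per: "y + p \<in> Y \<longleftrightarrow> y \<in> Y" for y
    by (simp add: Y_def lift_set_def)
  have fin: "finite Q" "Q \<noteq> {}"
    using finite_invariant[OF Q] rl by auto
  have Min: "Min Q \<in> Q" using fin by simp
  obtain \<pi> :: "int \<Rightarrow> int" where \<pi>0: "\<pi> 0 = Min Q" and inc: "\<And>i. \<pi> i < \<pi> (i + 1)"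
    and ran: "range \<pi> = Y"
    using enumerate_periodic_int_set[OF p_pos per QY[OF Min]] by blast
  note less_iff = increasing_int_seq_less_iff[of \<pi>, OF inc]
  have le_iff: "\<pi> i \<le> \<pi> j \<longleftrightarrow> i \<le> j" for i j
    using less_iff[of j i] by linarith
  have Y: "\<pi> i \<in> Y" for i using ran by blast
  \<comment> \<open>Translation by \<open>p\<close> preserves the order of \<open>Y\<close>, so it
    shifts indices; the amount \<open>N\<close> is the number of points in one period.\<close>
  obtain N where N: "\<And>i. \<pi> i + p = \<pi> (i + N)"
  proof (rule increasing_surjection_is_shift[of \<pi> "\<lambda>y. y + p", OF inc])
    have "y \<in> (\<lambda>y. y + p) ` Y" if "y \<in> Y" for y
      using per[of "y - p"] that by (intro image_eqI[of _ _ "y - p"]) auto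
    then show "(\<lambda>y. y + p) ` range \<pi> = range \<pi>"
      unfolding ran using per by auto
    show "x + p < y + p" if "x < y" for x y :: int
      using that by simp
  qed blast
  have "\<pi> 0 < \<pi> (0 + N)" using N[of 0] p_pos by linarith
  then have "0 < N" by (simp add: less_iff)
  define F where "F = lift_step (z1 + D) z1"
  obtain s where s: "\<And>i. F (\<pi> i) = \<pi> (i + s)"
  proof (rule increasing_surjection_is_shift[of \<pi> F, OF inc])
    show "F ` range \<pi> = range \<pi>"
      unfolding ran F_def Y_def by (rule lift_step_onto[OF Q]) simp_all
    show "F x < F y" if "x \<in> range \<pi>" "y \<in> range \<pi>" "x < y" for x y
      using that unfolding ran F_def Y_def by (rule lift_step_strict_mono[OF Q])
  qed blast
  have \<pi>0_range: "0 \<le> \<pi> 0" "\<pi> 0 < p"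
    using Q_range[OF Min] \<pi>0 by auto
  have neg: "\<pi> (- 1) < 0"
  proof (rule ccontr)
    assume "\<not> \<pi> (- 1) < 0"
    moreover have less: "\<pi> (- 1) < \<pi> 0" by (simp add: less_iff)
    ultimately have "\<pi> (- 1) \<in> Q" using Y_Q[OF Y, of "- 1"] \<pi>0_range by simp
    then have "\<pi> 0 \<le> \<pi> (- 1)" using fin \<pi>0 by simp
    then show False using less by simp
  qed
  have range: "0 \<le> \<pi> j \<and> \<pi> j < p" if "0 \<le> j" "j < N" for j
  proof -
    have "\<pi> 0 \<le> \<pi> j" "\<pi> j \<le> \<pi> (- 1 + N)" using that by (simp_all add: le_iff)
    then show ?thesis using N[of "- 1"] neg \<pi>0_range by linarith
  qed
  have mem: "\<pi> j \<in> Q" if "0 \<le> j" "j < N" for j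
    using range[OF that] Y_Q[OF Y] by blast
  have idx: "\<exists>j. r = \<pi> j \<and> 0 \<le> j \<and> j < N" if "r \<in> Q" for r
  proof -
    have "r \<in> range \<pi>" using QY[OF that] ran by simp
    then obtain j where j: "r = \<pi> j" by blast
    have "\<pi> 0 \<le> \<pi> j" using that fin \<pi>0 j by simp
    moreover have "\<pi> j < \<pi> (0 + N)" using Q_range[OF that] \<pi>0_range N[of 0] j by linarith
    ultimately show ?thesis using j by (auto simp: le_iff less_iff)
  qed
  \<comment> \<open>Bracketing \<open>z0 - 1\<close> puts a point equal to \<open>z0\<close> on the
    right. As \<open>Q\<close> avoids the hole, the indices from 0 to \<open>l\<close> are those of
    the left branch.\<close>
  obtain l where l: "\<pi> l \<le> z0 - 1" "z0 - 1 < \<pi> (l + 1)"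
    using increasing_int_seq_bracket[of \<pi> "z0 - 1", OF inc] by blast
  define L where "L = l + 1"
  obtain jl where jl: "rl = \<pi> jl" "0 \<le> jl" "jl < N" using idx[OF rl(1)] by blast
  obtain jr where jr: "rr = \<pi> jr" "0 \<le> jr" "jr < N" using idx[OF rr(1)] by blast
  have "\<pi> jl < \<pi> L" using jl rl D_pos l by (simp add: L_def)
  then have "jl < L" by (simp add: less_iff)
  have "\<pi> l < \<pi> jr" using jr rr l by simp
  then have "l < jr" by (simp add: less_iff)
  have L: "0 < L" "L < N" using \<open>jl < L\<close> \<open>l < jr\<close> jl jr by (auto simp: L_def)
  have left_iff: "\<pi> j < z0 - D \<longleftrightarrow> j < L" if "0 \<le> j" "j < N" for j
  proof
    assume "\<pi> j < z0 - D"
    then have "\<pi> j < \<pi> L" using l D_pos by (simp add: L_def)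
    then show "j < L" by (simp add: less_iff)
  next
    assume "j < L"
    then have "\<pi> j \<le> \<pi> l" by (simp add: le_iff L_def)
    then show "\<pi> j < z0 - D" using l Q_split[OF mem[OF that]] by linarith
  qed
  have step: "\<pi> (j + s) = \<pi> j + z1 + (if j < L then D else 0)" if "0 \<le> j" "j < N" for j
    unfolding s[of j, symmetric] F_def lift_step_def
    using range[OF that] left_iff[OF that] by simp
  note period = add_multiple_of_quasi_period[of \<pi>, OF N[symmetric]]
  have "coprime s N"
  proof -
    define g where "g = gcd s N"
    have g: "g dvd s" "g dvd N" by (auto simp: g_def)
    \<comment> \<open>Every \<open>g\<close>-th point already forms an invariant set, so minimality
      forces \<open>g\<close> to divide 1.\<close>
    define Q' where "Q' = {\<pi> j | j. 0 \<le> j \<and> j < N \<and> g dvd j}"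
    have Q': "\<pi> j mod p \<in> Q'" if "g dvd j" for j
    proof -
      have "\<pi> j = \<pi> (j mod N) + (j div N) * p"
        using period[of "j mod N" "j div N"] by simp
      moreover have "0 \<le> j mod N" "j mod N < N" using \<open>0 < N\<close> by simp_all
      ultimately have "\<pi> j mod p = \<pi> (j mod N)" using range[of "j mod N"] by simp
      moreover have "g dvd j mod N" using that g by (simp add: dvd_mod_iff)
      ultimately show ?thesis using \<open>0 < N\<close> by (auto simp: Q'_def)
    qed
    have "Q' \<subseteq> Q" using mem by (auto simp: Q'_def)
    have "invariant Q'"
      unfolding invariant_def
    proof (intro conjI ballI)
      show "Q' \<noteq> {}" using Q'[of 0] by auto
      show "Q' \<subseteq> {0..<p}" using range by (auto simp: Q'_def)
      fix r assume "r \<in> Q'"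
      then obtain j where j: "r = \<pi> j" "0 \<le> j" "j < N" "g dvd j" by (auto simp: Q'_def)
      have "\<pi> (j + s) mod p \<in> Q'" using j g by (intro Q') simp
      then show "r < z0 - D \<and> (r + z1 + D) mod p \<in> Q' \<or> z0 \<le> r \<and> (r + z1) mod p \<in> Q'"
        using step[OF j(2,3)] left_iff[OF j(2,3)] Q_split[OF mem[OF j(2,3)]] j(1)
        by (cases "j < L") auto
    qed
    then have "Q' = Q"
      using min \<open>Q' \<subseteq> Q\<close> fin by (meson card_seteq)
    then have "\<pi> 1 \<in> Q'" using mem[of 1] L by simp
    then obtain j where "\<pi> 1 = \<pi> j" "g dvd j" by (auto simp: Q'_def)
    then have "g dvd 1" using less_iff[of 1 j] less_iff[of j 1] by simp
    then show ?thesis by (simp add: g_def coprime_iff_gcd_eq_1)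
  qed
  obtain u v where uv: "u * s + v * N = 1"
    using bezout_int[of s N] \<open>coprime s N\<close> by (auto simp: coprime_iff_gcd_eq_1)
  \<comment> \<open>\<open>u\<close> inverts \<open>s\<close> modulo \<open>N\<close>, so
    \<open>K * s\<close> is congruent to \<open>L\<close>. The upper ends of the long gaps are to be
    the residues of \<open>s, 2 * s, ..., K * s\<close>, the last one being the gap around the
    hole.\<close>
  define K where "K = (u * L) mod N"
  have "N dvd K * s - L"
  proof -
    have "K * s - L = (u * L - (u * L) div N * N) * s - L * (u * s + v * N)"
      by (simp add: K_def uv minus_div_mult_eq_mod)
    also have "\<dots> = N * (- ((u * L) div N * s) - L * v)" by (simp add: algebra_simps)
    finally show ?thesis by (metis dvd_triv_left)
  qed
  then obtain e where e: "K * s = L + e * N" by (auto simp: dvd_def algebra_simps)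
  have K: "0 < K" "K < N"
  proof -
    show "K < N" using \<open>0 < N\<close> by (simp add: K_def)
    have "K \<noteq> 0"
    proof
      assume "K = 0"
      then have "N dvd L" using \<open>N dvd K * s - L\<close> by simp
      then show False using L zdvd_imp_le[of N L] by simp
    qed
    moreover have "0 \<le> K" using \<open>0 < N\<close> by (simp add: K_def)
    ultimately show "0 < K" by simp
  qed
  \<comment> \<open>Both \<open>\<pi>\<close> and \<open>D * hits\<close> jump by the same amounts under the shifts by \<open>s\<close> and \<open>N\<close>, up to
    constants, so their difference is affine.\<close>
  define \<theta> where "\<theta> j = \<pi> j - D * hits N s K j" for j
  have \<theta>N: "\<theta> (j + N) = \<theta> j + (p - K * D)" for j
    using N[of j] hits_add_period[of N K s j] K by (simp add: \<theta>_def algebra_simps)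
  have \<theta>s0: "\<theta> (j + s) = \<theta> j + (z1 - e * D)" if "0 \<le> j" "j < N" for j
    using step[OF that] hits_add_shift_branch[OF _ e that L] K by (simp add: \<theta>_def algebra_simps)
  have \<theta>s: "\<theta> (j + s) = \<theta> j + (z1 - e * D)" for j
  proof -
    note period = add_multiple_of_quasi_period[of \<theta>, OF \<theta>N]
    have "\<theta> (j + s) = \<theta> ((j mod N + s) + (j div N) * N)" by (simp add: algebra_simps)
    also have "\<dots> = \<theta> (j mod N) + (z1 - e * D) + (j div N) * (p - K * D)"
      unfolding period using \<theta>s0[of "j mod N"] \<open>0 < N\<close> by simp
    also have "\<dots> = \<theta> (j mod N + (j div N) * N) + (z1 - e * D)" unfolding period by simp
    finally show ?thesis by simp
  qed
  obtain G where G: "\<And>j. \<theta> j = \<theta> 0 + j * G"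
    using coprime_quasi_periods_imp_affine[of \<theta>, OF \<theta>s \<theta>N \<open>coprime s N\<close>] by blast
  have \<pi>_eq: "\<pi> j = \<pi> 0 + j * G + D * hits N s K j" for j
    using G[of j] by (simp add: \<theta>_def)
  have p: "p = N * G + K * D"
    using \<theta>N[of 0] G[of N] by simp
  \<comment> \<open>No long gap ends at index 0, so the gap across 0 has length \<open>G\<close>; as
    0 lies in it, \<open>G\<close> is positive and \<open>\<pi> 0 < G\<close>.\<close>
  have "\<pi> (- 1) = \<pi> 0 - G"
    using \<pi>_eq[of "- 1"] hits_neg_1[OF \<open>coprime s N\<close> \<open>0 < N\<close>, of K] K by simp
  then have G_pos: "0 < G" and \<pi>0_less: "\<pi> 0 < G" using neg \<pi>0_range by auto
  define d where "d = int (card {n \<in> {1..K}. 0 < (n * s) mod N \<and> (n * s) mod N < L})"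
  have HL1: "hits N s K (L - 1) = d"
    using hits_eq_card[of "L - 1" N s K] L by (simp add: d_def)
  have HL: "hits N s K L = d + 1"
  proof -
    let ?E = "{n \<in> {1..K}. 0 < (n * s) mod N \<and> (n * s) mod N < L}"
    have KL: "(K * s) mod N = L" using e L by simp
    \<comment> \<open>Multiplication by \<open>s\<close> is injective modulo \<open>N\<close>, so
      \<open>hits\<close> rises by exactly one from \<open>L - 1\<close> to
      \<open>L\<close>.\<close>
    have "n = K" if n: "n \<in> {1..K}" "(n * s) mod N = L" for n
    proof -
      have "N dvd K * s - n * s" using n KL by (metis mod_eq_dvd_iff)
      then have "N dvd (K - n) * s" by (simp add: algebra_simps)
      then have "N dvd K - n"
        using \<open>coprime s N\<close> by (simp add: coprime_dvd_mult_left_iff coprime_commute)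
      then show ?thesis using n K zdvd_imp_le[of N "K - n"] by fastforce
    qed
    then have "{n \<in> {1..K}. 0 < (n * s) mod N \<and> (n * s) mod N \<le> L} = insert K ?E"
      using KL K L by (auto simp: order_le_less)
    moreover have "K \<notin> ?E" "finite ?E" using KL by (auto intro: finite_subset[of _ "{1..K}"])
    ultimately show ?thesis using hits_eq_card[of L N s K] L by (simp add: d_def)
  qed
  have "\<pi> (L - 1) < z0 - D" "z0 \<le> \<pi> L"
    using left_iff[of "L - 1"] l L by (auto simp: L_def)
  \<comment> \<open>The two points around the hole confine the left-hand difference to
    \<open>(\<pi> 0 - G, \<pi> 0]\<close>, and \<open>0 \<le> \<pi> 0 < G\<close>.\<close>
  then have "\<bar>z0 - (d + 1) * D - L * G\<bar> < G"
    using \<pi>_eq[of "L - 1"] \<pi>_eq[of L] \<pi>0_range \<pi>0_less by (simp add: HL1 HL algebra_simps)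
  moreover have "s * p = N * z1 + L * D"
  proof -
    have z1: "z1 = s * G + e * D" using \<theta>s[of 0] G[of s] by simp
    have "N * z1 + L * D = s * (N * G) + (L + e * N) * D" unfolding z1 by (simp add: algebra_simps)
    also have "\<dots> = s * p" unfolding e[symmetric] p by (simp add: algebra_simps)
    finally show ?thesis by simp
  qed
  ultimately have "gap_pattern N K L d G s"
    using K L G_pos p \<open>N dvd K * s - L\<close> \<open>coprime s N\<close> unfolding gap_pattern_def d_def by blast
  then show ?thesis by blast
qed

text \<open>An invariant set of least cardinality lies in one branch or meets both. In one branch it
  contains a full class modulo a gcd, whose extreme members must fit into that branch.\<close>

theorem invariant_iff:
  "(\<exists>Q. invariant Q) \<longleftrightarrow>
     z0 < gcd p z1 \<or> p + D - z0 < gcd p (z1 + D) \<or> (\<exists>N K L d G s. gap_pattern N K L d G s)"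
proof
  assume "\<exists>Q. invariant Q"
  then obtain Q where Q: "invariant Q" and min: "\<And>Q'. invariant Q' \<Longrightarrow> card Q \<le> card Q'"
    using ex_has_least_nat[of invariant _ card] by blast
  have "Q \<noteq> {}" using Q by (simp add: invariant_def)
  consider (right) "\<forall>r\<in>Q. z0 \<le> r" | (left) "\<forall>r\<in>Q. r < z0 - D"
    | (mixed) rl rr where "rl \<in> Q" "rl < z0 - D" "rr \<in> Q" "z0 \<le> rr"
    using Q unfolding invariant_def by blast
  then show "z0 < gcd p z1 \<or> p + D - z0 < gcd p (z1 + D) \<or> (\<exists>N K L d G s. gap_pattern N K L d G s)"
  proof cases
    case right
    have "r \<in> {0..<p} \<and> (r + z1) mod p \<in> Q" if "r \<in> Q" for r
      using Q that right D_pos by (fastforce elim: invariant_cases)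
    with \<open>Q \<noteq> {}\<close> obtain r where "r < gcd p z1" "r \<in> Q" by (rule translate_closed_mem)
    with right show ?thesis by fastforce
  next
    case left
    have "r \<in> {0..<p} \<and> (r + (z1 + D)) mod p \<in> Q" if "r \<in> Q" for r
      using Q that left by (fastforce elim: invariant_cases simp: add.assoc)
    with \<open>Q \<noteq> {}\<close> obtain r where "0 \<le> r" "p - gcd p (z1 + D) + r \<in> Q"
      by (rule translate_closed_mem)
    with left show ?thesis by fastforce
  next
    case mixed
    then show ?thesis using invariant_imp_gap_pattern[OF Q min] by blast
  qed
next
  assume "z0 < gcd p z1 \<or> p + D - z0 < gcd p (z1 + D) \<or> (\<exists>N K L d G s. gap_pattern N K L d G s)"
  then show "\<exists>Q. invariant Q"
    using coset_invariant_right coset_invariant_left gap_pattern_imp_invariant by blast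
qed

section \<open>Exact covers and invariant sets\<close>

lemma window_length_greater:
  assumes "1 \<le> n"
  shows "p < n * (p + D) + z0"
proof -
  have "1 * (p + D) \<le> n * (p + D)"
    using assms D_pos p_pos by (intro mult_right_mono) auto
  then show ?thesis using D_pos D_less by simp
qed

text \<open>The residues of the covering points are invariant: the point of window
  \<open>m + 1\<close> that replaces one leaving window \<open>m\<close> is forced to be its image
  under the branch map.\<close>

lemma exact_cover_imp_invariant:
  fixes n :: int
  defines "q \<equiv> p + D" and "C \<equiv> n * (p + D) + z0"
  assumes n: "1 \<le> n" and z1: "(n * q) mod p = z1 mod p" and "0 \<in> K"
    and cover: "\<And>m. \<exists>!k. k \<in> K \<and> 0 \<le> u - m * p + k * q \<and> u - m * p + k * q < C"
  shows "\<exists>Q. invariant Q"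
proof -
  have q: "p < q" using D_pos by (simp add: q_def)
  have C: "p < C" unfolding C_def using n by (rule window_length_greater)
  define Q where "Q = (\<lambda>k. (u + k * q) mod p) ` K"
  have "r < z0 - D \<and> (r + z1 + D) mod p \<in> Q \<or> z0 \<le> r \<and> (r + z1) mod p \<in> Q"
    if rQ: "r \<in> Q" for r
  proof -
    obtain k where k: "k \<in> K" "r = (u + k * q) mod p" using rQ by (auto simp: Q_def)
    define m where "m = (u + k * q) div p"
    have r: "u + k * q = m * p + r" "0 \<le> r" "r < p"
      using p_pos by (simp_all add: m_def k)
    obtain k' where k': "k' \<in> K" "0 \<le> u - (m + 1) * p + k' * q" "u - (m + 1) * p + k' * q < C"
      using cover[of "m + 1"] by blast
    \<comment> \<open>Two points in window \<open>m\<close> would coincide, but \<open>k\<close>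
      lies below window \<open>m + 1\<close>. So \<open>k'\<close> enters from beyond the upper end
      of window \<open>m\<close>.\<close>
    have "\<not> u - m * p + k' * q < C"
    proof
      assume less: "u - m * p + k' * q < C"
      have "0 \<le> u - m * p + k' * q" using k'(2) p_pos by (simp add: algebra_simps)
      moreover have "0 \<le> u - m * p + k * q" "u - m * p + k * q < C" using r C by auto
      ultimately have "k' = k" using cover[of m] k k' less by blast
      then show False using k'(2) r by (simp add: algebra_simps)
    qed
    \<comment> \<open>\<open>j\<close> is the excess of the jump over \<open>n\<close>; the position
      of \<open>k'\<close> leaves only \<open>j = 0\<close>, on the right branch, and
      \<open>j = 1\<close>, on the left one.\<close>
    define j where "j = k' - k - n"
    have k'_eq: "u + k' * q = m * p + r + n * q + j * q" using r by (simp add: j_def algebra_simps)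
    have j: "z0 \<le> r + j * q" "r + j * q < z0 + p"
      using \<open>\<not> u - m * p + k' * q < C\<close> k'(3) k'_eq by (simp_all add: C_def q_def algebra_simps)
    have "j < 2"
    proof (rule ccontr)
      assume "\<not> j < 2"
      then have "2 * q \<le> j * q" using q p_pos by (intro mult_right_mono) auto
      then show False using j r q z0_less by linarith
    qed
    moreover have "- 1 < j"
    proof (rule ccontr)
      assume "\<not> - 1 < j"
      then have "j * q \<le> (- 1) * q" using q p_pos by (intro mult_right_mono) auto
      then show False using j r q D_pos D_less by linarith
    qed
    ultimately consider "j = 0" | "j = 1" by linarith
    moreover have "(u + k' * q) mod p = (r + z1 + j * D) mod p"
    proof -
      have "u + k' * q = (r + j * D + n * q) + (m + j) * p"
        using k'_eq by (simp add: q_def algebra_simps)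
      then have "(u + k' * q) mod p = (r + j * D + n * q) mod p"
        by (simp only: mod_mult_self1)
      also have "\<dots> = (r + j * D + z1) mod p" using z1 by (intro mod_add_cong) simp_all
      finally show ?thesis by (simp add: algebra_simps)
    qed
    moreover have "(u + k' * q) mod p \<in> Q" using k' by (auto simp: Q_def)
    ultimately show ?thesis using j by cases (auto simp: q_def)
  qed
  moreover have "Q \<noteq> {}" "Q \<subseteq> {0..<p}" using \<open>0 \<in> K\<close> p_pos by (auto simp: Q_def)
  ultimately have "invariant Q" by (simp add: invariant_def)
  then show ?thesis ..
qed

text \<open>The cover is a two-sided orbit inside one coset of \<open>q\<close>. Its point
  \<open>y (i + 1)\<close> lies in window \<open>m\<close> exactly for
  \<open>e i < m \<le> e (i + 1)\<close>, and since \<open>e\<close> increases strictly, these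
  ranges partition the integers.\<close>

lemma invariant_imp_exact_cover:
  fixes n :: int
  defines "q \<equiv> p + D" and "C \<equiv> n * (p + D) + z0"
  assumes n: "1 \<le> n" and z1: "(n * q) mod p = z1 mod p" and Q: "invariant Q"
  shows "\<exists>u K. 0 \<in> K \<and> (\<forall>m. \<exists>!k. k \<in> K \<and> 0 \<le> u - m * p + k * q \<and> u - m * p + k * q < C)"
proof -
  have q: "p < q" using D_pos by (simp add: q_def)
  have C: "p < C" unfolding C_def using n by (rule window_length_greater)
  define F where "F = lift_step ((n + 1) * q) (n * q)"
  have "((n + 1) * q) mod p = (z1 + D) mod p"
  proof -
    have "(n + 1) * q = n * q + D + 1 * p" by (simp add: q_def algebra_simps)
    then have "((n + 1) * q) mod p = (n * q + D) mod p" by (simp only: mod_mult_self1)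
    also have "\<dots> = (z1 + D) mod p" using z1 by (intro mod_add_cong) simp_all
    finally show ?thesis .
  qed
  then have "F ` lift_set Q = lift_set Q"
    unfolding F_def using z1 by (intro lift_step_onto[OF Q])
  moreover obtain r where "r \<in> Q" using Q by (auto simp: invariant_def)
  then have "r \<in> lift_set Q" using Q by (auto simp: lift_set_def elim: invariant_cases)
  ultimately obtain y :: "int \<Rightarrow> int" where y: "\<And>i. y i \<in> lift_set Q" "\<And>i. y (i + 1) = F (y i)"
    using bi_infinite_orbit[of F "lift_set Q" r] by blast
  define e where "e i = y i div p" for i
  \<comment> \<open>Moved back by the window length, \<open>y (i + 1)\<close> falls into the block
    of length \<open>p\<close> that contains \<open>y i\<close>: it is then \<open>y i\<close> plus
    \<open>p + D - z0\<close> on the left branch and \<open>y i - z0\<close> on the right.\<close>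
  have next_div: "(y (i + 1) - C) div p = e i" for i
  proof -
    define w where "w = y (i + 1) - C - y i"
    have "y i mod p \<in> Q" using y(1)[of i] by (simp add: lift_set_def)
    with Q have "0 \<le> y i mod p + w \<and> y i mod p + w < p"
    proof (cases rule: invariant_cases)
      case 1
      then have "w = p + D - z0"
        unfolding w_def y(2) by (simp add: F_def lift_step_def C_def q_def algebra_simps)
      then show ?thesis using 1 z0_less D_pos by simp
    next
      case 2
      then have "w = - z0"
        unfolding w_def y(2) by (simp add: F_def lift_step_def C_def q_def)
      then show ?thesis using 2 D_pos D_less by simp
    qed
    then have div_0: "(y i mod p + w) div p = 0" by simp
    have "y i + w = (y i mod p + w) + y i div p * p" by simp
    then have "(y i + w) div p = ((y i mod p + w) + y i div p * p) div p" by (rule arg_cong)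
    also have "\<dots> = y i div p" using p_pos div_0 by (subst div_mult_self1) auto
    finally show ?thesis by (simp add: w_def e_def)
  qed
  have inc: "e i < e (i + 1)" for i
  proof -
    have "e i + 1 = (y (i + 1) - C + p) div p" using next_div[of i] p_pos by simp
    also have "\<dots> \<le> e (i + 1)" unfolding e_def using C p_pos by (intro zdiv_mono1) auto
    finally show ?thesis by simp
  qed
  \<comment> \<open>The summand 0 gives this the shape of a quasi-period with zero
    increment.\<close>
  have "y (i + 1) mod q = y i mod q + 0" for i
  proof -
    have "y (i + 1) = y i + (if y i mod p < z0 - D then n + 1 else n) * q"
      by (simp add: y(2) F_def lift_step_def)
    then show ?thesis by (simp only: mod_mult_self1 add_0_right)
  qed
  from add_multiple_of_quasi_period[of "\<lambda>i. y i mod q", OF this, of 0]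
  have y_mod: "y i mod q = y 0 mod q" for i
    by (metis add.left_neutral add.right_neutral mult.right_neutral mult_zero_right)
  have idx: "\<exists>k. y i = y 0 + k * q" for i
  proof -
    have "q dvd y i - y 0" using y_mod[of i] by (simp add: mod_eq_dvd_iff)
    then show ?thesis by (auto simp: dvd_def algebra_simps)
  qed
  define K where "K = {k. \<exists>i. y i = y 0 + k * q}"
  have window: "0 \<le> y (i + 1) - m * p \<and> y (i + 1) - m * p < C \<longleftrightarrow> e i \<le> m - 1 \<and> m - 1 < e (i + 1)" for i m
  proof -
    have le_div: "m \<le> x div p \<longleftrightarrow> m * p \<le> x" for x
    proof
      assume "m \<le> x div p"
      then have "m * p \<le> x div p * p" using p_pos by simp
      also have "\<dots> \<le> x" using p_pos pos_mod_sign[of p x] div_mult_mod_eq[of x p] by linarith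
      finally show "m * p \<le> x" .
    next
      assume "m * p \<le> x"
      then have "m * p div p \<le> x div p" using p_pos by (rule zdiv_mono1)
      then show "m \<le> x div p" using p_pos by simp
    qed
    have "m \<le> e (i + 1) \<longleftrightarrow> m * p \<le> y (i + 1)"
      unfolding e_def by (rule le_div)
    moreover have "e i < m \<longleftrightarrow> y (i + 1) - C < m * p"
      unfolding next_div[symmetric] using le_div[of "y (i + 1) - C"] by linarith
    ultimately show ?thesis by auto
  qed
  have "\<exists>!k. k \<in> K \<and> 0 \<le> y 0 - m * p + k * q \<and> y 0 - m * p + k * q < C" for m
  proof -
    obtain i where i: "e i \<le> m - 1" "m - 1 < e (i + 1)"
      and uniq: "\<And>i'. e i' \<le> m - 1 \<Longrightarrow> m - 1 < e (i' + 1) \<Longrightarrow> i' = i"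
      using increasing_int_seq_bracket[of e "m - 1", OF inc] by blast
    obtain k where k: "y (i + 1) = y 0 + k * q" using idx by blast
    show ?thesis
    proof (rule ex1I[of _ k])
      have "k \<in> K" using k by (auto simp: K_def)
      then show "k \<in> K \<and> 0 \<le> y 0 - m * p + k * q \<and> y 0 - m * p + k * q < C"
        using window[of i m] i k by (simp add: algebra_simps)
    next
      fix k' assume k': "k' \<in> K \<and> 0 \<le> y 0 - m * p + k' * q \<and> y 0 - m * p + k' * q < C"
      then obtain i' where i': "y i' = y 0 + k' * q" by (auto simp: K_def)
      have "i' - 1 = i"
        using window[of "i' - 1" m] k' i' by (intro uniq) (simp_all add: algebra_simps)
      then have "y i' = y (i + 1)" by auto
      then have "k' * q = k * q" using i' k by simp
      then show "k' = k" using q p_pos by simp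
    qed
  qed
  moreover have "0 \<in> K" by (auto simp: K_def)
  ultimately show ?thesis by blast
qed

end

section \<open>Scaling to the integers\<close>

text \<open>All offsets and window ends are integer multiples of \<open>h\<close>, so a half-open
  window sees \<open>t\<close> only through \<open>\<lfloor>t / h\<rfloor>\<close>.\<close>

lemma M_row_scaled:
  fixes p q C :: int
  assumes h: "0 < h"
  shows "M_row (of_int p * h) (of_int q * h) (of_int C * h) t x m =
    (\<Sum>k\<in>{k. 0 \<le> \<lfloor>t / h\<rfloor> - m * p + k * q \<and> \<lfloor>t / h\<rfloor> - m * p + k * q < C}. x k)"
proof -
  have win: "0 \<le> t - of_int m * (of_int p * h) + of_int k * (of_int q * h) \<and>
      t - of_int m * (of_int p * h) + of_int k * (of_int q * h) < of_int C * h \<longleftrightarrow>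
    0 \<le> \<lfloor>t / h\<rfloor> - m * p + k * q \<and> \<lfloor>t / h\<rfloor> - m * p + k * q < C" for k
  proof -
    have "t - of_int m * (of_int p * h) + of_int k * (of_int q * h) = (t / h - of_int (m * p - k * q)) * h"
      using h by (simp add: field_simps)
    moreover have "0 \<le> (t / h - of_int (m * p - k * q)) * h \<longleftrightarrow> m * p - k * q \<le> \<lfloor>t / h\<rfloor>"
      using h by (simp add: zero_le_mult_iff le_floor_iff)
    moreover have "(t / h - of_int (m * p - k * q)) * h < of_int C * h \<longleftrightarrow> \<lfloor>t / h\<rfloor> < C + (m * p - k * q)"
      unfolding mult_less_cancel_right_pos[OF h] floor_less_iff by (simp add: algebra_simps)
    ultimately show ?thesis by auto
  qed
  show ?thesis
    unfolding M_row_def win by (intro sum.cong refl) (use win in \<open>auto simp: indicator_def\<close>)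
qed

lemma sum_01_eq_1_iff:
  fixes x :: "'a \<Rightarrow> real"
  assumes "finite W" and "\<And>k. x k \<in> {0, 1}"
  shows "sum x W = 1 \<longleftrightarrow> (\<exists>!k. x k = 1 \<and> k \<in> W)"
proof -
  have "sum x W = (\<Sum>k\<in>W. if x k = 1 then 1 else 0)"
    using assms(2) by (intro sum.cong) auto
  also have "\<dots> = real (card {k \<in> W. x k = 1})"
    using \<open>finite W\<close> by (simp add: sum.If_cases Int_def)
  finally have "sum x W = 1 \<longleftrightarrow> card {k \<in> W. x k = 1} = 1" by simp
  also have "\<dots> \<longleftrightarrow> (\<exists>!k. x k = 1 \<and> k \<in> W)"
    unfolding One_nat_def card_1_singleton_iff set_eq_iff by auto metis
  finally show ?thesis .
qed

text \<open>A 0/1 vector is the indicator of a set \<open>K\<close>, and a row sum equals 1 when one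
  element of \<open>K\<close> falls in the window; \<open>t\<close> and \<open>u\<close> correspond
  by \<open>u = \<lfloor>t / h\<rfloor>\<close> and \<open>t = u * h\<close>.\<close>

lemma S_set_scaled_nonempty_iff:
  fixes p q C :: int
  assumes h: "0 < h" and q: "0 < q"
  shows "S_set (of_int p * h) (of_int q * h) (of_int C * h) \<noteq> {} \<longleftrightarrow>
    (\<exists>u K. 0 \<in> K \<and> (\<forall>m. \<exists>!k. k \<in> K \<and> 0 \<le> u - m * p + k * q \<and> u - m * p + k * q < C))"
    (is "?L \<longleftrightarrow> ?R")
proof -
  have fin: "finite {k. 0 \<le> v + k * q \<and> v + k * q < C}" for v
  proof (rule finite_subset)
    show "{k. 0 \<le> v + k * q \<and> v + k * q < C} \<subseteq> {- \<bar>v\<bar>..\<bar>C\<bar> + \<bar>v\<bar>}"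
    proof
      fix k assume "k \<in> {k. 0 \<le> v + k * q \<and> v + k * q < C}"
      then have k: "0 \<le> v + k * q" "v + k * q < C" by auto
      have "\<bar>k\<bar> * 1 \<le> \<bar>k\<bar> * \<bar>q\<bar>" using q by (intro mult_left_mono) auto
      then have "\<bar>k\<bar> \<le> \<bar>k * q\<bar>" by (simp add: abs_mult)
      moreover have "0 \<le> k \<longleftrightarrow> 0 \<le> k * q" using q by (simp add: zero_le_mult_iff)
      ultimately show "k \<in> {- \<bar>v\<bar>..\<bar>C\<bar> + \<bar>v\<bar>}" using k by simp linarith
    qed
  qed simp
  have row: "M_row (of_int p * h) (of_int q * h) (of_int C * h) t x m = 1 \<longleftrightarrow>
      (\<exists>!k. x k = 1 \<and> 0 \<le> \<lfloor>t / h\<rfloor> - m * p + k * q \<and> \<lfloor>t / h\<rfloor> - m * p + k * q < C)"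
    if "\<And>k. x k \<in> {0, 1}" for t x m
    unfolding M_row_scaled[OF h] by (subst sum_01_eq_1_iff[OF fin that]) simp
  show ?thesis
  proof
    assume ?L
    then obtain t x where x: "\<And>k. x k \<in> {0, 1}" "x 0 = 1"
      "\<And>m. M_row (of_int p * h) (of_int q * h) (of_int C * h) t x m = 1"
      unfolding S_set_def by blast
    then show ?R
      using row[of x t] by (intro exI[of _ "\<lfloor>t / h\<rfloor>"] exI[of _ "{k. x k = 1}"]) simp
  next
    assume ?R
    then obtain u K where K: "0 \<in> K"
      "\<And>m. \<exists>!k. k \<in> K \<and> 0 \<le> u - m * p + k * q \<and> u - m * p + k * q < C" by blast
    have "of_int u * h \<in> S_set (of_int p * h) (of_int q * h) (of_int C * h)"
      unfolding S_set_def
    proof (intro CollectI exI[of _ "indicator K :: int \<Rightarrow> real"] conjI allI)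
      show "indicator K k \<in> {0, 1 :: real}" for k by (simp add: indicator_def)
      then show "M_row (of_int p * h) (of_int q * h) (of_int C * h) (of_int u * h) (indicator K) m = 1" for m
        using K(2)[of m] h by (subst row) (simp_all add: indicator_eq_1_iff)
    qed (use K in simp)
    then show ?L by blast
  qed
qed

lemma in_lat_scaled_iff:
  assumes "0 < h"
  shows "in_lat (of_int x * h) (of_int y * h) \<longleftrightarrow> y dvd x"
proof -
  have "of_int x * h = of_int k * (of_int y * h) \<longleftrightarrow> x = y * k" for k
  proof -
    have "of_int x * h = of_int k * (of_int y * h) \<longleftrightarrow> (of_int x :: real) = of_int (y * k)"
      using assms by auto
    then show ?thesis by (simp only: of_int_eq_iff)
  qed
  then show ?thesis by (simp add: in_lat_def dvd_def)
qed

lemma lat_gcd_scaled: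
  assumes h: "0 < h" and "x \<noteq> 0 \<or> y \<noteq> 0"
  shows "lat_gcd h (of_int x * h) (of_int y * h) = of_int (gcd x y) * h"
  unfolding lat_gcd_def
proof (rule Greatest_equality)
  have "0 < gcd x y" using assms(2) by simp
  then show "in_lat (of_int (gcd x y) * h) h \<and> 0 < of_int (gcd x y) * h \<and>
      in_lat (of_int x * h) (of_int (gcd x y) * h) \<and> in_lat (of_int y * h) (of_int (gcd x y) * h)"
    using h by (auto simp: in_lat_scaled_iff in_lat_def[of _ h])
next
  fix d assume d: "in_lat d h \<and> 0 < d \<and> in_lat (of_int x * h) d \<and> in_lat (of_int y * h) d"
  then obtain k where k: "d = of_int k * h" by (auto simp: in_lat_def)
  then have "k dvd gcd x y" using d h by (simp add: in_lat_scaled_iff)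
  then have "k \<le> gcd x y" using assms(2) by (intro zdvd_imp_le) auto
  then show "d \<le> of_int (gcd x y) * h" using k h by simp
qed

section \<open>Gap patterns and the real-number form of condition 3\<close>

context two_branch
begin

text \<open>In units of \<open>h\<close>, \<open>X\<close> is \<open>x\<close> and \<open>Bd\<close>
  is \<open>N * G\<close>. Divisibility by \<open>a\<close> makes \<open>x = s * p\<close>, and
  cancelling \<open>p\<close> leaves the conditions on \<open>s\<close>, \<open>K\<close> and
  \<open>L\<close>.\<close>

lemma gap_pattern_scaled_iff:
  fixes h a b c0 c1 :: real and d1 d2 d3 d4 :: nat
  assumes h: "0 < h" and a: "a = of_int p * h" and b: "b = of_int (p + D) * h"
    and c0: "c0 = of_int z0 * h" and c1: "c1 = of_int z1 * h"
  shows "(let N = real (d1 + d2 + d3 + d4 + 2);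
              Bd = a - real (d1 + d2 + 1) * (b - a);
              X = N * c1 + real (d1 + d3 + 1) * (b - a)
          in 0 < Bd \<and> in_lat Bd (N * h)
            \<and> in_lat X a
            \<and> in_lat (real (d1 + d2 + 1) * X - real (d1 + d3 + 1) * a) (N * a)
            \<and> (\<exists>\<delta>. c0 = real (d1 + 1) * (b - a) + real (d1 + d3 + 1) * Bd / N + \<delta>
                   \<and> - min (Bd / N) (a - c0) < \<delta> \<and> \<delta> < min (Bd / N) (c0 + a - b))
            \<and> lat_gcd h X (N * a) = a
            \<and> card {n::int. 1 \<le> n \<and> n \<le> int (d1 + d2 + 1) \<and>
                     (\<exists>k::int. 0 < of_int n * X - of_int k * (N * a)
                              \<and> of_int n * X - of_int k * (N * a) < real (d1 + d3 + 1) * a)}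
              = d1) \<longleftrightarrow>
    (\<exists>G s. gap_pattern (int (d1 + d2 + d3 + d4 + 2)) (int (d1 + d2 + 1)) (int (d1 + d3 + 1)) (int d1) G s)"
proof -
  define N K L where NKL: "N = int (d1 + d2 + d3 + d4 + 2)" "K = int (d1 + d2 + 1)" "L = int (d1 + d3 + 1)"
  have K: "0 < K" "K < N" "int d1 + 1 \<le> K" and L: "0 < L" "L < N" by (auto simp: NKL)
  let ?N = "real (d1 + d2 + d3 + d4 + 2)"
  let ?Bd = "a - real (d1 + d2 + 1) * (b - a)"
  let ?X = "?N * c1 + real (d1 + d3 + 1) * (b - a)"
  let ?E = "{n::int. 1 \<le> n \<and> n \<le> int (d1 + d2 + 1) \<and>
    (\<exists>k::int. 0 < of_int n * ?X - of_int k * (?N * a)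
            \<and> of_int n * ?X - of_int k * (?N * a) < real (d1 + d3 + 1) * a)}"
  let ?D = "\<exists>\<delta>. c0 = real (d1 + 1) * (b - a) + real (d1 + d3 + 1) * ?Bd / ?N + \<delta>
    \<and> - min (?Bd / ?N) (a - c0) < \<delta> \<and> \<delta> < min (?Bd / ?N) (c0 + a - b)"
  have of_int: "?N = of_int N" "real (d1 + d2 + 1) = of_int K" "real (d1 + d3 + 1) = of_int L"
    by (simp_all add: NKL)
  define x where "x = N * z1 + L * D"
  have Bd: "?Bd = of_int (p - K * D) * h"
    unfolding of_int a b by (simp add: algebra_simps)
  have X: "?X = of_int x * h"
    unfolding of_int a b c1 x_def by (simp add: algebra_simps)
  have Na: "?N * a = of_int (N * p) * h"
    unfolding of_int a by (simp add: algebra_simps)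
  have pos_iff: "0 < ?Bd \<longleftrightarrow> 0 < p - K * D"
    unfolding Bd using h by (simp only: zero_less_mult_iff of_int_0_less_iff) auto
  have lat1: "in_lat ?Bd (?N * h) \<longleftrightarrow> N dvd p - K * D"
    unfolding Bd unfolding of_int by (rule in_lat_scaled_iff[OF h])
  have lat2: "in_lat ?X a \<longleftrightarrow> p dvd x"
    unfolding X unfolding a by (rule in_lat_scaled_iff[OF h])
  have lat3: "in_lat (real (d1 + d2 + 1) * ?X - real (d1 + d3 + 1) * a) (?N * a) \<longleftrightarrow>
      N * p dvd K * x - L * p"
  proof -
    have "real (d1 + d2 + 1) * ?X - real (d1 + d3 + 1) * a = of_int (K * x - L * p) * h"
      unfolding X unfolding of_int a by (simp add: algebra_simps)
    then show ?thesis unfolding Na by (simp only: in_lat_scaled_iff[OF h])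
  qed
  have gcd: "lat_gcd h ?X (?N * a) = a \<longleftrightarrow> gcd x (N * p) = p"
  proof -
    have "lat_gcd h ?X (?N * a) = of_int (gcd x (N * p)) * h"
      unfolding X Na using K p_pos by (intro lat_gcd_scaled[OF h]) simp
    then show ?thesis unfolding a using h by simp
  qed
  have E: "?E = {n \<in> {1..K}. 0 < (n * s) mod N \<and> (n * s) mod N < L}" if s: "x = s * p" for s
  proof -
    have "(\<exists>k::int. 0 < of_int n * ?X - of_int k * (?N * a) \<and>
        of_int n * ?X - of_int k * (?N * a) < real (d1 + d3 + 1) * a) \<longleftrightarrow>
      0 < (n * s) mod N \<and> (n * s) mod N < L" for n
    proof -
      have diff: "of_int n * ?X - of_int k * (?N * a) = of_int (n * s - k * N) * a" for k
        unfolding X Na s unfolding a by (simp add: algebra_simps)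
      have "0 < a" using a h p_pos by simp
      have "0 < of_int n * ?X - of_int k * (?N * a) \<longleftrightarrow> 0 < n * s - k * N" for k
        unfolding diff using \<open>0 < a\<close> by (simp only: zero_less_mult_iff of_int_0_less_iff) auto
      moreover have "of_int n * ?X - of_int k * (?N * a) < real (d1 + d3 + 1) * a \<longleftrightarrow> n * s - k * N < L" for k
        unfolding diff unfolding of_int mult_less_cancel_right_pos[OF \<open>0 < a\<close>] by (rule of_int_less_iff)
      moreover have "(\<exists>k. 0 < n * s - k * N \<and> n * s - k * N < L) \<longleftrightarrow>
          0 < (n * s) mod N \<and> (n * s) mod N < L"
      proof
        assume "\<exists>k. 0 < n * s - k * N \<and> n * s - k * N < L"
        then obtain k where k: "0 < n * s - k * N" "n * s - k * N < L" by blast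
        \<comment> \<open>As \<open>L < N\<close>, a representative in \<open>(0, L)\<close> is
          already the residue.\<close>
        have "(n * s) mod N = (n * s - k * N) mod N"
          using mod_mult_self1[of "n * s" "- k" N] by simp
        then have "(n * s) mod N = n * s - k * N" using k L by simp
        then show "0 < (n * s) mod N \<and> (n * s) mod N < L" using k by simp
      next
        assume "0 < (n * s) mod N \<and> (n * s) mod N < L"
        then show "\<exists>k. 0 < n * s - k * N \<and> n * s - k * N < L"
          by (intro exI[of _ "(n * s) div N"]) (simp add: minus_div_mult_eq_mod)
      qed
      ultimately show ?thesis by simp
    qed
    then show ?thesis by (auto simp: NKL)
  qed
  have delta: "?D \<longleftrightarrow> \<bar>z0 - (int d1 + 1) * D - L * G\<bar> < G" if G: "p = N * G + K * D" "0 < G" for G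
  proof -
    \<comment> \<open>The only candidate for \<open>\<delta>\<close> is \<open>w * h\<close>, so the
      existential becomes a set of bounds on \<open>w\<close>.\<close>
    define w where "w = z0 - (int d1 + 1) * D - L * G"
    have BdG: "?Bd = of_int N * (of_int G * h)" unfolding Bd using G by (simp add: algebra_simps)
    have BdN: "?Bd / ?N = of_int G * h"
      unfolding BdG unfolding of_int using K by simp
    have LBdN: "real (d1 + d3 + 1) * ?Bd / ?N = of_int (L * G) * h"
      unfolding BdG unfolding of_int using K by simp
    have "c0 = real (d1 + 1) * (b - a) + real (d1 + d3 + 1) * ?Bd / ?N + \<delta> \<longleftrightarrow> \<delta> = of_int w * h" for \<delta>
      unfolding LBdN unfolding a b c0 w_def by (auto simp: algebra_simps)
    then have "?D \<longleftrightarrow> - min (?Bd / ?N) (a - c0) < of_int w * h \<and> of_int w * h < min (?Bd / ?N) (c0 + a - b)"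
      by simp
    also have "\<dots> \<longleftrightarrow> - G < w \<and> z0 - p < w \<and> w < G \<and> w < z0 - D"
    proof -
      have diffs: "a - c0 = of_int (p - z0) * h" "c0 + a - b = of_int (z0 - D) * h"
        unfolding a b c0 by (simp_all add: algebra_simps)
      have neg_less: "- (of_int i * h) < of_int j * h \<longleftrightarrow> - i < j" for i j
      proof -
        have "- (of_int i * h) < of_int j * h \<longleftrightarrow> (of_int (- i) :: real) * h < of_int j * h" by simp
        then show ?thesis unfolding mult_less_cancel_right_pos[OF h] of_int_less_iff .
      qed
      have less: "of_int i * h < of_int j * h \<longleftrightarrow> i < j" for i j
        unfolding mult_less_cancel_right_pos[OF h] of_int_less_iff ..
      have min: "- min u v < w' \<longleftrightarrow> - u < w' \<and> - v < w'" for u v w' :: real by auto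
      show ?thesis unfolding BdN diffs min min_less_iff_conj neg_less less by auto
    qed
    also have "\<dots> \<longleftrightarrow> \<bar>w\<bar> < G"
    proof -
      \<comment> \<open>With \<open>p = N * G + K * D\<close>, these estimates place
        \<open>w\<close> between \<open>z0 - p\<close> and \<open>z0 - D\<close>.\<close>
      have "(int d1 + 1) * D \<le> K * D" "L * G < N * G" "0 \<le> int d1 * D" "0 < L * G"
        using K L G(2) D_pos by simp_all
      then have "z0 - p < w" "w < z0 - D" using G(1) by (simp_all add: w_def algebra_simps)
      then show ?thesis by auto
    qed
    finally show ?thesis by (simp add: w_def)
  qed
  have div_iff: "N * p dvd K * x - L * p \<longleftrightarrow> N dvd K * s - L"
    and gcd_iff: "gcd x (N * p) = p \<longleftrightarrow> coprime s N" if s: "x = s * p" for s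
  proof -
    have "K * x - L * p = (K * s - L) * p" using s by (simp add: algebra_simps)
    then show "N * p dvd K * x - L * p \<longleftrightarrow> N dvd K * s - L" using p_pos by simp
    have "gcd x (N * p) = gcd s N * p"
      using p_pos gcd_mult_distrib_int[of p s N] by (simp add: s mult.commute)
    then show "gcd x (N * p) = p \<longleftrightarrow> coprime s N" using p_pos by (simp add: coprime_iff_gcd_eq_1)
  qed
  have "(0 < p - K * D \<and> N dvd p - K * D \<and> p dvd x \<and> N * p dvd K * x - L * p \<and> ?D \<and>
      gcd x (N * p) = p \<and> card ?E = d1) \<longleftrightarrow> (\<exists>G s. gap_pattern N K L (int d1) G s)"
  proof
    assume asm: "0 < p - K * D \<and> N dvd p - K * D \<and> p dvd x \<and> N * p dvd K * x - L * p \<and> ?D \<and>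
      gcd x (N * p) = p \<and> card ?E = d1"
    then obtain G where "p - K * D = N * G" unfolding dvd_def by blast
    then have G: "p = N * G + K * D" "0 < G"
      using asm K by (simp_all add: zero_less_mult_iff)
    obtain s where s: "x = s * p" using asm unfolding dvd_def by (auto simp: mult.commute)
    have "gap_pattern N K L (int d1) G s"
      using asm K L G s x_def unfolding gap_pattern_def delta[OF G] E[OF s] div_iff[OF s] gcd_iff[OF s]
      by metis
    then show "\<exists>G s. gap_pattern N K L (int d1) G s" by blast
  next
    assume "\<exists>G s. gap_pattern N K L (int d1) G s"
    then obtain G s where gp: "gap_pattern N K L (int d1) G s" by blast
    then have G: "p = N * G + K * D" "0 < G" and s: "x = s * p"
      unfolding gap_pattern_def x_def by metis+
    have rest: "N dvd K * s - L" "\<bar>z0 - (int d1 + 1) * D - L * G\<bar> < G" "coprime s N"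
      "int (card {n \<in> {1..K}. 0 < (n * s) mod N \<and> (n * s) mod N < L}) = int d1"
      using gp unfolding gap_pattern_def by blast+
    have E_card: "card ?E = d1" using rest(4) unfolding E[OF s] by (simp only: of_nat_eq_iff)
    have eq: "p - K * D = N * G" using G by simp
    have NG: "0 < p - K * D" "N dvd p - K * D" unfolding eq using G K by simp_all
    have "p dvd x" using s by simp
    show "0 < p - K * D \<and> N dvd p - K * D \<and> p dvd x \<and> N * p dvd K * x - L * p \<and> ?D \<and>
      gcd x (N * p) = p \<and> card ?E = d1"
      unfolding delta[OF G] div_iff[OF s] gcd_iff[OF s]
      using NG \<open>p dvd x\<close> rest(1-3) E_card by (intro conjI)
  qed
  then show ?thesis
    unfolding Let_def pos_iff lat1 lat2 lat3 gcd NKL[symmetric] .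
qed

text \<open>The residues of \<open>n * s\<close> are distinct, and \<open>n = K\<close> hits
  \<open>L\<close>. So \<open>d\<close> of the others lie below \<open>L\<close> and
  \<open>K - 1 - d\<close> above it; the available room makes all four counts nonnegative.\<close>

lemma gap_pattern_ex_nat_iff:
  "(\<exists>N K L d G s. gap_pattern N K L d G s) \<longleftrightarrow>
   (\<exists>d1 d2 d3 d4 :: nat. \<exists>G s.
      gap_pattern (int (d1 + d2 + d3 + d4 + 2)) (int (d1 + d2 + 1)) (int (d1 + d3 + 1)) (int d1) G s)"
proof
  assume "\<exists>N K L d G s. gap_pattern N K L d G s"
  then obtain N K L d G s where gp: "gap_pattern N K L d G s" by blast
  define E where "E = {n \<in> {1..K}. 0 < (n * s) mod N \<and> (n * s) mod N < L}"
  have K: "0 < K" "K < N" and L: "0 < L" "L < N" and dv: "N dvd K * s - L" and cop: "coprime s N"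
    and d: "int (card E) = d"
    using gp unfolding gap_pattern_def E_def by blast+
  have KL: "(K * s) mod N = L"
    using dv L by (metis mod_eq_dvd_iff mod_pos_pos_trivial order_less_imp_le)
  have inj: "inj_on (\<lambda>n. (n * s) mod N) {1..K}"
  proof (rule inj_onI)
    fix m n assume mn: "m \<in> {1..K}" "n \<in> {1..K}" "(m * s) mod N = (n * s) mod N"
    then have "N dvd (m - n) * s" by (simp add: mod_eq_dvd_iff left_diff_distrib)
    then have "N dvd m - n"
      using cop by (simp add: coprime_dvd_mult_left_iff coprime_commute)
    then show "m = n" using mn K dvd_imp_le_int[of "m - n" N] by fastforce
  qed
  have nz: "0 < (n * s) mod N" if "n \<in> {1..K}" for n
    using that cop K by (intro coprime_mult_mod_pos) auto
  have finE: "finite E" by (rule finite_subset[of _ "{1..K}"]) (auto simp: E_def)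
  define E' where "E' = {1..K} - E - {K}"
  have "K \<notin> E" using KL by (simp add: E_def)
  have "E \<subseteq> {1..K} - {K}" using \<open>K \<notin> E\<close> by (auto simp: E_def)
  then have "card E \<le> card ({1..K} - {K})" by (intro card_mono) auto
  then have d_less_K: "d \<le> K - 1" using d K by (simp add: card_Diff_singleton)
  have "card E \<le> card {1..L - 1}"
    by (rule card_inj_on_le[of "\<lambda>n. (n * s) mod N"])
       (use inj in \<open>auto simp: E_def intro: inj_on_subset\<close>)
  then have d_less_L: "d \<le> L - 1" using d L by simp
  have "card E' \<le> card {L + 1..N - 1}"
  proof (rule card_inj_on_le[of "\<lambda>n. (n * s) mod N"])
    show "inj_on (\<lambda>n. (n * s) mod N) E'"
      using inj by (rule inj_on_subset) (auto simp: E'_def)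
    show "(\<lambda>n. (n * s) mod N) ` E' \<subseteq> {L + 1..N - 1}"
    proof
      fix r assume "r \<in> (\<lambda>n. (n * s) mod N) ` E'"
      then obtain n where n: "n \<in> {1..K}" "n \<notin> E" "n \<noteq> K" "r = (n * s) mod N"
        unfolding E'_def by blast
      have "r \<noteq> L" using inj_onD[OF inj, of n K] n KL K by auto
      moreover have "\<not> r < L" using n nz[OF n(1)] by (auto simp: E_def)
      moreover have "r < N" using n K by simp
      ultimately show "r \<in> {L + 1..N - 1}" by simp
    qed
  qed simp
  moreover have "int (card E') = K - d - 1"
  proof -
    have "insert K E \<subseteq> {1..K}" using K by (auto simp: E_def)
    moreover have "E' = {1..K} - insert K E" by (auto simp: E'_def)
    ultimately have "card E' = card {1..K} - card (insert K E)"
      using finE by (simp add: card_Diff_subset)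
    then show ?thesis using \<open>K \<notin> E\<close> finE d K d_less_K by simp
  qed
  ultimately have "K - d - 1 \<le> N - 1 - L" using L by simp
  moreover define d1 d2 d3 d4 where
    "d1 = nat d" "d2 = nat (K - 1 - d)" "d3 = nat (L - 1 - d)" "d4 = nat (N - K - L + d)"
  ultimately have "N = int (d1 + d2 + d3 + d4 + 2)" "K = int (d1 + d2 + 1)" "L = int (d1 + d3 + 1)"
    "d = int d1"
    using d_less_K d_less_L d by auto
  then show "\<exists>d1 d2 d3 d4 :: nat. \<exists>G s.
      gap_pattern (int (d1 + d2 + d3 + d4 + 2)) (int (d1 + d2 + 1)) (int (d1 + d3 + 1)) (int d1) G s"
    using gp by blast
qed blast

end

theorem theorem7p1:
  fixes a b c c0 c1 :: real and p q :: nat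
  defines "c0 \<equiv> c - of_int \<lfloor>c / b\<rfloor> * b"
      and "c1 \<equiv> of_int \<lfloor>c / b\<rfloor> * b - of_int \<lfloor>of_int \<lfloor>c / b\<rfloor> * b / a\<rfloor> * a"
  assumes pos: "0 < a" "a < b" "b < c"
      and c0_bd: "b - a < c0" "c0 < a"
      and c1_bd: "0 < c1" "c1 < 2 * a - b"
      and fl: "\<lfloor>c / b\<rfloor> \<ge> 2"
      and pq: "0 < p" "0 < q" "coprime p q" "a / b = real p / real q"
      and cb: "\<exists>k::int. c / b = of_int k / real q"
  shows "S_set a b c \<noteq> {} \<longleftrightarrow>
     (c0 < lat_gcd (b / real q) a c1
      \<or> b - c0 < lat_gcd (b / real q) a (c1 + b)
      \<or> (\<exists>d1 d2 d3 d4 :: nat.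
           let N = real (d1 + d2 + d3 + d4 + 2);
               Bd = a - real (d1 + d2 + 1) * (b - a);
               X = N * c1 + real (d1 + d3 + 1) * (b - a)
           in 0 < Bd \<and> in_lat Bd (N * (b / real q))
            \<and> in_lat X a
            \<and> in_lat (real (d1 + d2 + 1) * X - real (d1 + d3 + 1) * a) (N * a)
            \<and> (\<exists>\<delta>. c0 = real (d1 + 1) * (b - a) + real (d1 + d3 + 1) * Bd / N + \<delta>
                   \<and> - min (Bd / N) (a - c0) < \<delta> \<and> \<delta> < min (Bd / N) (c0 + a - b))
            \<and> lat_gcd (b / real q) X (N * a) = a
            \<and> card {n::int. 1 \<le> n \<and> n \<le> int (d1 + d2 + 1) \<and>
                     (\<exists>k::int. 0 < of_int n * X - of_int k * (N * a)
                              \<and> of_int n * X - of_int k * (N * a) < real (d1 + d3 + 1) * a)}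
              = d1))"
proof -
  \<comment> \<open>In this unit \<open>a\<close>, \<open>b\<close>, \<open>c\<close> become the
    integers \<open>p\<close>, \<open>q\<close>, \<open>C\<close>, by the hypotheses on
    \<open>a / b\<close> and \<open>c / b\<close>.\<close>
  define h where "h = b / real q"
  have "0 < b" using pos by simp
  have h: "0 < h" using \<open>0 < b\<close> pq by (simp add: h_def)
  define P D n :: int where PDn: "P = int p" "D = int q - int p" "n = \<lfloor>c / b\<rfloor>"
  obtain C :: int where C: "c / b = of_int C / real q" using cb by blast
  define f where "f = \<lfloor>of_int n * b / a\<rfloor>"
  define z0 z1 where z: "z0 = C - n * (P + D)" "z1 = n * (P + D) - f * P"
  have a_eq: "a = of_int P * h"
    using pq(4) \<open>0 < b\<close> pq(2) by (simp add: PDn h_def field_simps)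
  have b_eq: "b = of_int (P + D) * h" using pq(2) by (simp add: PDn h_def)
  have c_eq: "c = of_int C * h"
    using C \<open>0 < b\<close> pq(2) by (simp add: h_def field_simps)
  have nb: "of_int n * b = of_int (n * (P + D)) * h" by (subst b_eq) simp
  have fa: "of_int f * a = of_int (f * P) * h" by (simp add: a_eq)
  have c0_eq: "c0 = of_int z0 * h"
    unfolding c0_def PDn(3)[symmetric] nb by (simp add: c_eq z algebra_simps)
  have c1_eq: "c1 = of_int z1 * h"
    unfolding c1_def PDn(3)[symmetric] f_def[symmetric]
    unfolding nb fa by (simp add: z algebra_simps)
  have less: "of_int i * h < of_int j * h \<longleftrightarrow> i < j" for i j
    unfolding mult_less_cancel_right_pos[OF h] of_int_less_iff ..
  have "0 < P" using pq(1) by (simp add: PDn)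
  interpret two_branch P D z0 z1
  proof
    show "0 < D" using pos(2) less[of P "P + D"] a_eq b_eq by simp
    show "D < z0" using c0_bd(1) less[of D z0] by (simp add: a_eq b_eq c0_eq algebra_simps)
    show "z0 < P" using c0_bd(2) less[of z0 P] a_eq c0_eq by simp
  qed
  have C_eq: "C = n * (P + D) + z0" by (simp add: z)
  have z1_mod: "(n * (P + D)) mod P = z1 mod P"
    unfolding z using mod_mult_self1[of "n * (P + D)" "- f" P] by simp
  have n: "1 \<le> n" using fl by (simp add: PDn)
  have "S_set a b c \<noteq> {} \<longleftrightarrow>
      (\<exists>u K. 0 \<in> K \<and> (\<forall>m. \<exists>!k. k \<in> K \<and> 0 \<le> u - m * P + k * (P + D) \<and> u - m * P + k * (P + D) < C))"
    unfolding a_eq c_eq by (subst b_eq, rule S_set_scaled_nonempty_iff[OF h]) (use D_pos \<open>0 < P\<close> in simp)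
  also have "\<dots> \<longleftrightarrow> (\<exists>Q. invariant Q)"
    unfolding C_eq using exact_cover_imp_invariant[OF n z1_mod] invariant_imp_exact_cover[OF n z1_mod]
    by metis
  also have "\<dots> \<longleftrightarrow> z0 < gcd P z1 \<or> P + D - z0 < gcd P (z1 + D) \<or> (\<exists>N K L d G s. gap_pattern N K L d G s)"
    by (rule invariant_iff)
  also have "z0 < gcd P z1 \<longleftrightarrow> c0 < lat_gcd (b / real q) a c1"
    unfolding h_def[symmetric] a_eq c0_eq c1_eq using \<open>0 < P\<close>
    by (subst lat_gcd_scaled[OF h]) (simp_all only: less, simp)
  also have "P + D - z0 < gcd P (z1 + D) \<longleftrightarrow> b - c0 < lat_gcd (b / real q) a (c1 + b)"
  proof -
    have "c1 + b = of_int (z1 + (P + D)) * h" "b - c0 = of_int (P + D - z0) * h"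
      by (simp_all add: c1_eq c0_eq b_eq algebra_simps)
    \<comment> \<open>\<open>b\<close> is \<open>P + D\<close> units, and the gcd with
      \<open>P\<close> ignores the summand \<open>P\<close>.\<close>
    moreover have "gcd P (z1 + (P + D)) = gcd P (z1 + D)"
      using gcd_add2[of P "z1 + D"] by (simp add: algebra_simps)
    moreover have "lat_gcd h (of_int P * h) (of_int (z1 + (P + D)) * h) = of_int (gcd P (z1 + (P + D))) * h"
      using \<open>0 < P\<close> by (intro lat_gcd_scaled[OF h]) simp
    ultimately show ?thesis unfolding h_def[symmetric] a_eq by (simp only: less)
  qed
  finally show ?thesis
    unfolding gap_pattern_ex_nat_iff h_def[symmetric]
      gap_pattern_scaled_iff[OF h a_eq b_eq c0_eq c1_eq] .
qed

end
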